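(* Let $U\in\mathrm U(N)$ be drawn from the cyclic Pólya ensemble associated to the weight $\omega\in\widetilde L_N^1(\mathbb S_1)$. (1) The spherical transform of $U$ is $$\mathcal S^{(U)}(s)=\prod_{j=1}^N\frac{\mathcal S\omega(s_j)}{\mathcal S\omega(j-1)}\qquad\text{for all } s=(s_1,\ldots,s_N)\in\mathbb I_N .$$ (2) The spherical transform of the inverse random matrix $U^{-1}$ is $$\mathcal S^{(U^{-1})}(s)=\prod_{j=1}^N\frac{\mathcal S\omega(N-s_j-1)}{\mathcal S\omega(N-j)}\qquad\text{for all } s\in\mathbb I_N .$$ Therefore $U^{-1}$ is drawn from a cyclic Pólya ensemble too, with the weight $\widetilde\omega(z')={z'}^{1-N}\omega({z'}^{-1})=[\omega({z'}^{-1})]^*$.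
   Context: $\mathbb S_1=\{z\in\mathbb C: |z|=1\}$ carries the normalised Haar measure $\frac{dz'}{2\pi i z'}$ (i.e. $\frac{d\theta}{2\pi}$ for $z'=e^{i\theta}$); functions are identified when equal almost everywhere. A star denotes complex conjugation, and $z'\partial_{z'}=-i\,\frac{d}{d\theta}$. $\Delta_N(z)=\prod_{1\le a<b\le N}(z_b-z_a)$. For $w\in L^1(\mathbb S_1)$ and $s\in\mathbb Z$, $\mathcal Sw(s)=\int_{\mathbb S_1}\frac{dz'}{2\pi i z'}{z'}^{s}w(z')$. $\mathbb I_N=\{(s_1,\ldots,s_N)\in\mathbb Z^N: s_a\ne s_b \text{ for } a\neq b\}$. For $s\in\mathbb I_N$ and $U\in\mathrm U(N)$ with eigenvalues $z_1,\ldots,z_N$ the spherical function is $$\Phi(U;s)=\Big(\prod_{j=0}^{N-1}j!\Big)\frac{\det[z_a^{s_b}]_{a,b=1,\ldots,N}}{\Delta_N(z)\Delta_N(s)}$$ (extended by continuity to coinciding eigenvalues). The spherical transform of a random matrix $U\in\mathrm U(N)$ is $\mathcal S^{(U)}(s)=\mathbb E[\Phi(U;s)]$, $s\in\mathbb I_N$. $L_N^1(\mathbb S_1)=\{w\in L^1(\mathbb S_1): [w(z)]^*=z^{N-1}w(z)\}$. $\widetilde L_N^1(\mathbb S_1)$ is the set of $w\in L_N^1(\mathbb S_1)$ that are $(N-1)$-times differentiable with $\partial^jw\in L^1(\mathbb S_1)$ for $j=0,\ldots,N-1$; here this means that for $N\ge2$ $w$ is $(N-2)$-times continuously differentiable with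 $\partial^{N-2}w$ absolutely continuous, so that $\partial^{N-1}w$ need only exist almost everywhere. Cyclic Pólya ensemble: a unitarily invariant random matrix $U\in\mathrm U(N)$ (distribution invariant under conjugation by every $V\in\mathrm U(N)$) is drawn from the cyclic Pólya ensemble associated to $\omega\in\widetilde L_N^1(\mathbb S_1)$ iff its eigenvalues $z_1,\ldots,z_N\in\mathbb S_1$ have joint probability density, with respect to $\prod_{j=1}^N\frac{dz_j}{2\pi i z_j}$, $$p_N^{(U)}(z)=\frac{1}{N!\prod_{j=0}^{N-1}[j!\,\mathcal S\omega(j)]}\,\Delta_N(z)\det[(-z_a\partial_{z_a})^{b-1}\omega(z_a)]_{a,b=1,\ldots,N}\ge0 ,$$ where it is part of the definition that $\prod_{j=0}^{N-1}\mathcal S\omega(j)>0$. *)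

theory Defs
  imports "HOL-Probability.Probability"
begin

text \<open>
  Throughout, \<open>N = CARD('n)\<close>. A finite linearly ordered type \<open>'n\<close> plays the role of the index set
  \<open>{1, \<dots>, N}\<close>, so an \<open>N\<close>-tuple is a function on \<open>'n\<close>; \<open>pos a\<close> is the number in
  \<open>{1, \<dots>, N}\<close> that corresponds to \<open>a\<close>.
\<close>

definition pos :: "'n::{finite,linorder} \<Rightarrow> nat" where
  "pos a = card {..a}"

definition vandermonde :: "('n::{finite,linorder} \<Rightarrow> complex) \<Rightarrow> complex" where
  "vandermonde z = (\<Prod>(a, b)\<in>{(a, b). a < b}. z b - z a)"


subsection \<open>Functions on the unit circle\<close>

text \<open>
  A function on the circle is a function on \<open>complex\<close> of which only the values on
  \<open>sphere 0 1\<close> are ever used; accordingly the space of the measure is the circle itself.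
\<close>

definition circle_haar :: "complex measure" where
  "circle_haar =
     distr (uniform_measure lborel {0..<2 * pi}) (restrict_space borel (sphere 0 1)) cis"

definition circle_transform :: "(complex \<Rightarrow> complex) \<Rightarrow> int \<Rightarrow> complex" where
  "circle_transform w s = (LINT z|circle_haar. z powi s * w z)"

text \<open>
  \<open>z\<partial>\<^sub>z = -\<i> d/d\<theta>\<close>, where \<open>d/d\<theta>\<close> is taken along \<open>t \<mapsto> z e\<^sup>i\<^sup>t\<close> at \<open>t = 0\<close>. At a point where this
  derivative does not exist, the value is an unspecified constant.
\<close>

definition zderiv :: "(complex \<Rightarrow> complex) \<Rightarrow> complex \<Rightarrow> complex" where
  "zderiv f z = - \<i> * vector_derivative (\<lambda>t. f (z * cis t)) (at 0)"

definition circle_differentiable :: "(complex \<Rightarrow> complex) \<Rightarrow> complex \<Rightarrow> bool" where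
  "circle_differentiable f z \<longleftrightarrow> (\<lambda>t::real. f (z * cis t)) differentiable at 0"

definition absolutely_continuous_on :: "real set \<Rightarrow> (real \<Rightarrow> complex) \<Rightarrow> bool" where
  "absolutely_continuous_on S f \<longleftrightarrow>
     (\<forall>\<epsilon>>0. \<exists>\<delta>>0. \<forall>\<D>. \<D> division_of \<Union>\<D> \<and> \<Union>\<D> \<subseteq> S \<and> (\<Sum>K\<in>\<D>. measure lborel K) < \<delta>
        \<longrightarrow> (\<Sum>K\<in>\<D>. norm (f (Sup K) - f (Inf K))) < \<epsilon>)"

definition L1 :: "nat \<Rightarrow> (complex \<Rightarrow> complex) set" where
  "L1 N = {w. integrable circle_haar w \<and> (AE z in circle_haar. cnj (w z) = z ^ (N - 1) * w z)}"

text \<open>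
  A class of almost everywhere equal functions is represented by its regular member: for
  \<open>N \<ge> 2\<close> the elements of \<open>L1_diff N\<close> are themselves \<open>(N - 2)\<close>-times continuously
  differentiable, rather than merely equal almost everywhere to such a function.
\<close>

definition L1_diff :: "nat \<Rightarrow> (complex \<Rightarrow> complex) set" where
  "L1_diff N = {w \<in> L1 N.
     (\<forall>j\<le>N - 1. integrable circle_haar ((zderiv ^^ j) w)) \<and>
     (N \<ge> 2 \<longrightarrow>
        (\<forall>j<N - 2. \<forall>z\<in>sphere 0 1. circle_differentiable ((zderiv ^^ j) w) z) \<and>
        (\<forall>j\<le>N - 2. continuous_on (sphere 0 1) ((zderiv ^^ j) w)) \<and>
        absolutely_continuous_on {0..2 * pi} (\<lambda>t. (zderiv ^^ (N - 2)) w (cis t)) \<and>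
        (AE z in circle_haar. circle_differentiable ((zderiv ^^ (N - 2)) w) z))}"


subsection \<open>Random unitary matrices\<close>

definition adjoint_matrix :: "complex^'n^'n \<Rightarrow> complex^'n^'n" where
  "adjoint_matrix A = map_matrix cnj (transpose A)"

definition unitary_group :: "(complex^'n^'n) set" where
  "unitary_group = {V. V ** adjoint_matrix V = mat 1 \<and> adjoint_matrix V ** V = mat 1}"

definition random_unitary :: "'a measure \<Rightarrow> ('a \<Rightarrow> complex^'n^'n) \<Rightarrow> bool" where
  "random_unitary M U \<longleftrightarrow>
     prob_space M \<and> U \<in> borel_measurable M \<and> (\<forall>x\<in>space M. U x \<in> unitary_group)"

definition unitarily_invariant :: "'a measure \<Rightarrow> ('a \<Rightarrow> complex^'n^'n) \<Rightarrow> bool" where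
  "unitarily_invariant M U \<longleftrightarrow>
     (\<forall>V\<in>unitary_group. distr M borel (\<lambda>x. V ** U x ** adjoint_matrix V) = distr M borel U)"

text \<open>
  An enumeration of the eigenvalues with multiplicities, i.e. of the roots of the
  characteristic polynomial. It is only ever used in ways that do not depend on the order.
\<close>

definition eigenvalues :: "complex^'n^'n \<Rightarrow> 'n \<Rightarrow> complex" where
  "eigenvalues A = (SOME z. \<forall>x. det (mat x - A) = (\<Prod>a\<in>UNIV. x - z a))"

abbreviation torus_haar :: "('n::finite \<Rightarrow> complex) measure" where
  "torus_haar \<equiv> Pi\<^sub>M UNIV (\<lambda>_. circle_haar)"

text \<open>
  The eigenvalues form an unordered tuple, hence their joint density \<open>p\<close> (a symmetric function)
  is tested on permutation invariant events.
\<close>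

definition has_eigenvalue_density ::
    "'a measure \<Rightarrow> ('a \<Rightarrow> complex^'n^'n) \<Rightarrow> (('n \<Rightarrow> complex) \<Rightarrow> complex) \<Rightarrow> bool" where
  "has_eigenvalue_density M U p \<longleftrightarrow>
     (AE z in torus_haar. p z \<in> \<real> \<and> Re (p z) \<ge> 0) \<and>
     (\<forall>B\<in>sets torus_haar. (\<forall>\<pi>. bij \<pi> \<longrightarrow> (\<forall>z\<in>B. z \<circ> \<pi> \<in> B)) \<longrightarrow>
        {x \<in> space M. eigenvalues (U x) \<in> B} \<in> sets M \<and>
        emeasure M {x \<in> space M. eigenvalues (U x) \<in> B} =
          (\<integral>\<^sup>+z\<in>B. ennreal (Re (p z)) \<partial>torus_haar))"


subsection \<open>Spherical transform\<close>

definition spherical_ratio :: "('n::{finite,linorder} \<Rightarrow> int) \<Rightarrow> ('n \<Rightarrow> complex) \<Rightarrow> complex" where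
  "spherical_ratio s z =
     (\<Prod>j<CARD('n). fact j) *
     (det (\<chi> a b. z a powi s b) / (vandermonde z * vandermonde (\<lambda>a. of_int (s a))))"

definition spherical_function ::
    "complex^'n::{finite,linorder}^'n::{finite,linorder} \<Rightarrow> ('n \<Rightarrow> int) \<Rightarrow> complex" where
  "spherical_function A s =
     (let z = eigenvalues A in
      if inj z then spherical_ratio s z
      else Lim (at z within {y. inj y \<and> (\<forall>a. y a \<in> sphere 0 1)}) (spherical_ratio s))"

definition spherical_transform ::
    "'a measure \<Rightarrow> ('a \<Rightarrow> complex^'n::{finite,linorder}^'n::{finite,linorder}) \<Rightarrow> ('n \<Rightarrow> int) \<Rightarrow> complex" where
  "spherical_transform M U s = (LINT x|M. spherical_function (U x) s)"


subsection \<open>Cyclic Polya ensembles\<close>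

definition polya_density ::
    "(complex \<Rightarrow> complex) \<Rightarrow> ('n::{finite,linorder} \<Rightarrow> complex) \<Rightarrow> complex" where
  "polya_density w z =
     1 / (fact CARD('n) * (\<Prod>j<CARD('n). fact j * circle_transform w (int j))) *
     vandermonde z * det (\<chi> a b. ((\<lambda>f x. - zderiv f x) ^^ (pos b - 1)) w (z a))"

definition cyclic_polya_ensemble ::
    "'a measure \<Rightarrow> ('a \<Rightarrow> complex^'n::{finite,linorder}^'n::{finite,linorder}) \<Rightarrow> (complex \<Rightarrow> complex) \<Rightarrow> bool" where
  "cyclic_polya_ensemble M U w \<longleftrightarrow>
     random_unitary M U \<and> unitarily_invariant M U \<and>
     w \<in> L1_diff CARD('n) \<and>
     (\<Prod>j<CARD('n). circle_transform w (int j)) \<in> \<real> \<and> Re (\<Prod>j<CARD('n). circle_transform w (int j)) > 0 \<and>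
     has_eigenvalue_density M U (polya_density w)"

end

theory Submission
  imports Defs "HOL-Computational_Algebra.Fundamental_Theorem_Algebra"
begin

text \<open>
  The Vandermonde determinant in the density cancels against the denominator of the spherical
  function, so \<open>E[\<Phi>(U; s)]\<close> is a constant times the integral over the torus of
  \<open>det[z\<^sub>a^s\<^sub>b] det[(-z\<partial>)^(b-1) \<omega>(z\<^sub>a)]\<close>. By Andreief's identity this is \<open>N!\<close> times the determinant of
  the moments of the derivatives of \<open>\<omega>\<close>, and integration by parts turns these into
  \<open>s\<^sub>a^(b-1) S\<omega>(s\<^sub>a)\<close>; what remains is \<open>\<Prod>\<^sub>a S\<omega>(s\<^sub>a)\<close> times the Vandermonde determinant of \<open>s\<close>.

  The inverse of a unitary matrix is its adjoint, whose eigenvalues are the conjugates. As the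
  reflected weight is \<open>cnj (\<omega> (cnj z))\<close>, its density is the complex conjugate of the density of
  \<open>\<omega>\<close> at the conjugate point, and the latter is real. So \<open>U\<^sup>-\<^sup>1\<close> belongs to the reflected weight
  and the second formula is an instance of the first.
\<close>

section \<open>Alternants and the Vandermonde determinant\<close>

text \<open>Regularity is the main obstacle. The derivative of order \<open>N - 1\<close> exists
  only almost everywhere, so integration by parts rests on the fundamental theorem for absolutely
  continuous functions, proved with the gauge integral; there is no boundary term because z^s f(z)
  is periodic in the angle. Where a derivative fails to exist, \<open>zderiv\<close> is an
  unspecified constant: identities between top derivatives then hold only almost everywhere, and
  measurability for the reflected weight requires that the set of differentiability be measurable. A
  second obstacle is the quotient 0/0 in the spherical function at coinciding eigenvalues. Newton
  interpolation with the entries of z as nodes writes every alternant, without any division, as the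
  Vandermonde determinant times a polynomial in z. This makes the continuous extension explicit, so
  its continuity and measurability can be read off; its symmetry follows by approximation with
  distinct eigenvalues.\<close>

lemma permutes_le_imp_id:
  fixes p :: "'n::{finite,linorder} \<Rightarrow> 'n"
  assumes "p permutes UNIV" "\<And>i. p i \<le> i"
  shows "p = id"
proof (rule ccontr)
  assume "p \<noteq> id"
  then have ne: "{i. p i \<noteq> i} \<noteq> {}" by (auto simp: fun_eq_iff)
  define m where "m = Min {i. p i \<noteq> i}"
  have m: "p m \<noteq> m" and least: "\<And>i. p i \<noteq> i \<Longrightarrow> m \<le> i"
    using Min_in[OF _ ne] by (auto simp: m_def)
  have "p m < m" using assms(2)[of m] m by simp
  \<comment> \<open>Below the least moved point everything is fixed, so \<open>p m\<close> is fixed,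
    and injectivity would force \<open>p m = m\<close>.\<close>
  then have "p (p m) = p m" using least[of "p m"] by fastforce
  then show False using m permutes_inj[OF assms(1)] by (auto dest: injD)
qed

text \<open>A permutation other than the identity moves some index upwards and so picks up a zero
  entry above the diagonal.\<close>

lemma det_triangular:
  fixes A :: "'a::comm_ring_1^'n::{finite,linorder}^'n::{finite,linorder}"
  assumes "\<And>i j. i < j \<Longrightarrow> A $ i $ j = 0"
  shows "det A = (\<Prod>i\<in>UNIV. A $ i $ i)"
proof -
  have "det A = (\<Sum>p\<in>{id}. of_int (sign p) * (\<Prod>i\<in>UNIV. A $ i $ p i))"
    unfolding det_def
  proof (rule sum.mono_neutral_right)
    show "\<forall>p\<in>{p. p permutes UNIV} - {id}. of_int (sign p) * (\<Prod>i\<in>UNIV. A $ i $ p i) = 0"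
    proof
      fix p :: "'n \<Rightarrow> 'n" assume "p \<in> {p. p permutes UNIV} - {id}"
      then obtain i where "i < p i"
        using permutes_le_imp_id[of p] by (auto simp: not_le[symmetric])
      then have "\<exists>i\<in>UNIV. A $ i $ p i = 0" using assms by auto
      then have "(\<Prod>i\<in>UNIV. A $ i $ p i) = 0" by (metis finite prod_zero)
      then show "of_int (sign p) * (\<Prod>i\<in>UNIV. A $ i $ p i) = 0" by simp
    qed
  qed (auto simp: permutes_id)
  then show ?thesis by (simp add: sign_id)
qed

lemma pos_eq_Suc: "pos a = Suc (card {..<a})" for a :: "'n::{finite,linorder}"
proof -
  have "{..a} = insert a {..<a}" by auto
  then show ?thesis unfolding pos_def by simp
qed

lemma pos_minus_1: "pos a - 1 = card {..<a}" for a :: "'n::{finite,linorder}"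
  by (simp add: pos_eq_Suc)

lemma card_lessThan_strict_mono:
  fixes a b :: "'n::{finite,linorder}"
  assumes "a < b" shows "card {..<a} < card {..<b}"
  using assms by (intro psubset_card_mono) auto

lemma bij_betw_card_lessThan:
  "bij_betw (\<lambda>a::'n::{finite,linorder}. card {..<a}) UNIV {..<CARD('n)}"
proof -
  have inj: "inj (\<lambda>a::'n. card {..<a})"
    by (rule injI) (metis card_lessThan_strict_mono less_irrefl linorder_neqE)
  have sub: "range (\<lambda>a::'n. card {..<a}) \<subseteq> {..<CARD('n)}"
    by (auto intro!: psubset_card_mono)
  have "range (\<lambda>a::'n. card {..<a}) = {..<CARD('n)}"
    using card_subset_eq[OF _ sub] by (simp add: card_image[OF inj])
  with inj show ?thesis by (simp add: bij_betw_def)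
qed

lemma image_card_lessThan:
  "(\<lambda>a. card {..<a}) ` {..<c} = {..<card {..<c}}" for c :: "'n::{finite,linorder}"
proof (rule card_subset_eq)
  show "(\<lambda>a. card {..<a}) ` {..<c} \<subseteq> {..<card {..<c}}"
    using card_lessThan_strict_mono by auto
  have "inj_on (\<lambda>a::'n. card {..<a}) {..<c}"
    using bij_betw_card_lessThan by (metis bij_betw_def inj_on_subset top_greatest)
  then show "card ((\<lambda>a. card {..<a}) ` {..<c}) = card {..<card {..<c}}"
    by (simp add: card_image)
qed simp

text \<open>The divided differences of \<open>x \<mapsto> x ^ k\<close> at the nodes \<open>y 0, \<dots>, y c\<close>, i.e. complete
  homogeneous symmetric polynomials.\<close>

fun newton_coeff :: "(nat \<Rightarrow> 'a::comm_ring_1) \<Rightarrow> nat \<Rightarrow> nat \<Rightarrow> 'a" where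
  "newton_coeff y 0 0 = 1"
| "newton_coeff y 0 (Suc c) = 0"
| "newton_coeff y (Suc k) 0 = y 0 * newton_coeff y k 0"
| "newton_coeff y (Suc k) (Suc c) = y (Suc c) * newton_coeff y k (Suc c) + newton_coeff y k c"

lemma newton_coeff_eq_0: "k < c \<Longrightarrow> newton_coeff y k c = 0"
  by (induction y k c rule: newton_coeff.induct) auto

lemma newton_coeff_self [simp]: "newton_coeff y k k = 1"
  by (induction k) (auto simp: newton_coeff_eq_0)

text \<open>Newton interpolation of the monomial; it is exact because all divided differences of
  order above k vanish.\<close>

lemma newton_expansion:
  fixes x :: "'a::comm_ring_1"
  shows "x ^ k = (\<Sum>c\<le>k. newton_coeff y k c * (\<Prod>d<c. x - y d))"
proof (induction k)
  case (Suc k)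
  define P where "P c = (\<Prod>d<c. x - y d)" for c
  \<comment> \<open>Multiplying a Newton basis element by x in this way reproduces the recursion of
    \<open>newton_coeff\<close>.\<close>
  have P: "x * P c = P (Suc c) + y c * P c" for c by (simp add: P_def algebra_simps)
  have "x ^ Suc k = (\<Sum>c\<le>k. newton_coeff y k c * (x * P c))"
    by (simp add: Suc P_def sum_distrib_left algebra_simps)
  also have "\<dots> = (\<Sum>c\<le>k. newton_coeff y k c * P (Suc c)) + (\<Sum>c\<le>Suc k. y c * newton_coeff y k c * P c)"
    by (simp add: P algebra_simps sum.distrib newton_coeff_eq_0)
  also have "\<dots> = (\<Sum>c\<le>Suc k. newton_coeff y (Suc k) c * P c)"
    by (simp add: sum.atMost_Suc_shift algebra_simps sum.distrib del: sum.atMost_Suc)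
  finally show ?case by (simp add: P_def)
qed simp

text \<open>Transports the tuple to natural indices. Beyond the last index the value is arbitrary,
  but a coefficient \<open>newton_coeff y k c\<close> only involves the nodes up to c, and c stays
  in range.\<close>

definition nodes :: "('n::{finite,linorder} \<Rightarrow> 'a) \<Rightarrow> nat \<Rightarrow> 'a" where
  "nodes z i = z (inv (\<lambda>a. card {..<a}) i)"

lemma nodes_card [simp]: "nodes z (card {..<a}) = z a" for a :: "'n::{finite,linorder}"
  using bij_betw_card_lessThan[where 'n='n]
  by (simp add: nodes_def bij_betw_def inv_f_f[of "\<lambda>a::'n. card {..<a}"])

text \<open>Each power z_a^k is expanded in the Newton basis whose nodes are the entries of z
  themselves. This factors the alternant matrix into a lower triangular matrix, with determinant
  \<open>vandermonde z\<close>, and a matrix of divided differences. Nothing is divided, so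
  coinciding entries are allowed.\<close>

lemma alternant_eq:
  fixes z :: "'n::{finite,linorder} \<Rightarrow> complex"
  shows "det (\<chi> a b. z a ^ k b) =
    vandermonde z * det (\<chi> c b. newton_coeff (nodes z) (k b) (card {..<c}))"
proof -
  define T :: "complex^'n::{finite,linorder}^'n::{finite,linorder}" where "T = (\<chi> a c. \<Prod>d<c. z a - z d)"
  define H :: "complex^'n::{finite,linorder}^'n::{finite,linorder}" where "H = (\<chi> c b. newton_coeff (nodes z) (k b) (card {..<c}))"
  have prodeq: "(\<Prod>d<card {..<c}. x - nodes z d) = (\<Prod>d<c. x - z d)" for c x
  proof -
    have "inj_on (\<lambda>a::'n. card {..<a}) {..<c}"
      using bij_betw_card_lessThan by (metis bij_betw_def inj_on_subset top_greatest)
    then show ?thesis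
      by (subst image_card_lessThan[symmetric], subst prod.reindex) simp_all
  qed
  have "z a ^ m = (\<Sum>c\<in>UNIV. (\<Prod>d<c. z a - z d) * newton_coeff (nodes z) m (card {..<c}))" for a m
  proof -
    define f where "f c = newton_coeff (nodes z) m c * (\<Prod>d<c. z a - nodes z d)" for c
    \<comment> \<open>Beyond m the coefficient vanishes; from N on the product contains the factor
      of the node z_a itself. Hence both sums can be taken over the same N indices.\<close>
    have f0: "f c = 0" if "c > m \<or> c \<ge> CARD('n)" for c
    proof (cases "c > m")
      case False
      with that have "CARD('n) \<le> c" by simp
      moreover have "card {..<a} < CARD('n)"
        using bij_betw_card_lessThan[where 'n='n] by (auto simp: bij_betw_def)
      ultimately have "\<exists>d\<in>{..<c}. z a - nodes z d = 0"
        by (intro bexI[of _ "card {..<a}"]) auto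
      then show ?thesis by (auto simp: f_def)
    qed (simp add: f_def newton_coeff_eq_0)
    have "z a ^ m = sum f {..m}" unfolding f_def by (rule newton_expansion)
    also have "\<dots> = sum f ({..m} \<union> {..<CARD('n)})"
      by (rule sum.mono_neutral_left) (auto simp: f0)
    also have "\<dots> = sum f {..<CARD('n)}"
      by (rule sum.mono_neutral_right) (auto simp: f0)
    also have "\<dots> = (\<Sum>c\<in>UNIV. f (card {..<c::'n}))"
      using sum.reindex_bij_betw[OF bij_betw_card_lessThan[where 'n='n], of f] by simp
    finally show ?thesis by (simp add: f_def prodeq mult.commute)
  qed
  then have "(\<chi> a b. z a ^ k b) = T ** H"
    by (simp add: vec_eq_iff matrix_matrix_mult_def T_def H_def)
  then have "det (\<chi> a b. z a ^ k b) = det T * det H" by (simp add: det_mul)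
  also have "det T = (\<Prod>a\<in>UNIV. \<Prod>d<a. z a - z d)"
    by (subst det_triangular) (auto simp: T_def)
  also have "\<dots> = (\<Prod>(a,d)\<in>(SIGMA a:UNIV. {..<a}). z a - z d)"
    by (rule prod.Sigma) auto
  also have "\<dots> = vandermonde z"
    unfolding vandermonde_def
    by (rule prod.reindex_bij_witness[of _ "\<lambda>(a,b). (b,a)" "\<lambda>(a,b). (b,a)"]) auto
  finally show ?thesis by (simp add: H_def)
qed

lemma vandermonde_eq_det:
  fixes z :: "'n::{finite,linorder} \<Rightarrow> complex"
  shows "vandermonde z = det (\<chi> a b. z a ^ (pos b - 1))"
proof -
  \<comment> \<open>For the exponents 0, ..., N - 1 the cofactor is upper unitriangular; transposing
    brings it into the form of \<open>det_triangular\<close>.\<close>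
  have "det (\<chi> c b. newton_coeff (nodes z) (card {..<b::'n}) (card {..<c::'n}))
      = det (transpose (\<chi> c b. newton_coeff (nodes z) (card {..<b::'n}) (card {..<c::'n})))"
    by simp
  also have "\<dots> = (1::complex)"
    by (subst det_triangular) (auto simp: transpose_def newton_coeff_eq_0 card_lessThan_strict_mono)
  finally show ?thesis unfolding pos_minus_1 by (subst alternant_eq) simp
qed

lemma vandermonde_permute:
  fixes z :: "'n::{finite,linorder} \<Rightarrow> complex"
  assumes "\<pi> permutes UNIV"
  shows "vandermonde (z \<circ> \<pi>) = of_int (sign \<pi>) * vandermonde z"
  using det_permute_rows[OF assms, of "\<chi> a b. z a ^ (pos b - 1)"]
  by (simp add: vandermonde_eq_det)

lemma vandermonde_eq_0_iff:
  fixes z :: "'n::{finite,linorder} \<Rightarrow> complex"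
  shows "vandermonde z = 0 \<longleftrightarrow> \<not> inj z"
proof -
  have "vandermonde z = 0 \<longleftrightarrow> (\<exists>a b. a < b \<and> z b = z a)"
    unfolding vandermonde_def by (subst prod_zero_iff) auto
  also have "\<dots> \<longleftrightarrow> \<not> inj z"
    by (auto simp: inj_def) (metis linorder_neqE)
  finally show ?thesis .
qed

lemma cnj_det: "cnj (det (A :: complex^'n^'n)) = det (map_matrix cnj A)"
  by (simp add: det_def map_matrix_def)

lemma cnj_vandermonde: "cnj (vandermonde z) = vandermonde (\<lambda>a. cnj (z a))"
  unfolding vandermonde_def by (simp add: case_prod_unfold)

section \<open>Eigenvalues\<close>

text \<open>Only the identity permutation contributes N linear factors to the determinant of x - A;
  every other one meets a constant off-diagonal entry. So the characteristic polynomial is monic of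
  degree N and splits, which gives the choice in \<open>eigenvalues\<close> its meaning.\<close>

lemma charpoly_splits:
  fixes A :: "complex^'n::finite^'n"
  shows "\<exists>z :: 'n \<Rightarrow> complex. \<forall>x. det (mat x - A) = (\<Prod>a\<in>UNIV. x - z a)"
proof -
  define P :: "complex poly^'n^'n" where
    "P = (\<chi> i j. if i = j then [:- A $ i $ i, 1:] else [:- A $ i $ j:])"
  define p where "p = det P"
  define t where "t q = of_int (sign q) * (\<Prod>i\<in>UNIV. P $ i $ q i)" for q
  define r where "r = sum t ({q. q permutes UNIV} - {id})"
  have poly_p: "poly p x = det (mat x - A)" for x
    by (simp add: p_def det_def poly_sum poly_prod P_def mat_def)
      (auto intro!: sum.cong prod.cong)
  have split: "p = t id + r"
    unfolding p_def det_def r_def t_def by (subst sum.remove[of _ id]) (auto simp: permutes_id)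
  have t_id: "t id = (\<Prod>i\<in>UNIV. [:- A $ i $ i, 1:])" by (simp add: t_def P_def sign_id)
  have deg_id: "degree (t id) = CARD('n)"
    unfolding t_id by (subst degree_prod_eq_sum_degree) auto
  have lead_id: "lead_coeff (t id) = 1"
    unfolding t_id by (simp add: lead_coeff_prod)
  have "degree (t q) < CARD('n)" if "q permutes UNIV" "q \<noteq> id" for q
  proof -
    from \<open>q \<noteq> id\<close> obtain i where i: "q i \<noteq> i" by (auto simp: fun_eq_iff)
    have "degree (t q) \<le> degree (\<Prod>i\<in>UNIV. P $ i $ q i)"
      unfolding t_def using degree_mult_le[of "of_int (sign q)" "\<Prod>i\<in>UNIV. P $ i $ q i"] by simp
    also have "\<dots> \<le> (\<Sum>i\<in>UNIV. degree (P $ i $ q i))"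
      using degree_prod_sum_le[of UNIV "\<lambda>i. P $ i $ q i"] by (simp add: o_def)
    also have "\<dots> < (\<Sum>i\<in>(UNIV::'n set). 1)"
      by (rule sum_strict_mono_ex1) (use i in \<open>auto simp: P_def intro!: exI[of _ i]\<close>)
    finally show ?thesis by simp
  qed
  then have deg_r: "degree r < CARD('n)"
    unfolding r_def by (intro degree_sum_less) auto
  have deg_p: "degree p = CARD('n)"
    unfolding split using deg_r deg_id by (subst degree_add_eq_left) auto
  have lead_p: "lead_coeff p = 1"
    using lead_id deg_id coeff_eq_0[OF deg_r] unfolding deg_p by (simp add: split)
  have "p \<noteq> 0" using lead_p by auto
  then obtain R where R: "size R = CARD('n)" "p = (\<Prod>x\<in>#R. [:-x, 1:])"
    using alg_closed_imp_factorization[of p] using lead_p by (auto simp: deg_p)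
  obtain xs where xs: "mset xs = R" using ex_mset by blast
  have len: "length xs = CARD('n)" using R xs by (metis size_mset)
  obtain h :: "'n \<Rightarrow> nat" where h: "bij_betw h UNIV {..<CARD('n)}"
    using ex_bij_betw_finite_nat[of "UNIV :: 'n set"] by (auto simp: lessThan_atLeast0)
  have "det (mat x - A) = (\<Prod>a\<in>UNIV. x - xs ! h a)" for x
  proof -
    have "det (mat x - A) = (\<Prod>y\<leftarrow>xs. x - y)"
      unfolding poly_p[symmetric] R xs[symmetric]
      by (induction xs) (auto simp: algebra_simps)
    also have "\<dots> = (\<Prod>i<CARD('n). x - xs ! i)"
      by (simp add: prod.list_conv_set_nth len lessThan_atLeast0)
    also have "\<dots> = (\<Prod>a\<in>UNIV. x - xs ! h a)"
      using prod.reindex_bij_betw[OF h, of "\<lambda>i. x - xs ! i"] by simp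
    finally show ?thesis .
  qed
  then show ?thesis by (intro exI[of _ "\<lambda>a. xs ! h a"] allI)
qed

lemma charpoly_eigenvalues:
  "det (mat x - A) = (\<Prod>a\<in>UNIV. x - eigenvalues A a)"
  unfolding eigenvalues_def by (rule someI_ex[OF charpoly_splits, THEN spec])

text \<open>Equal polynomials have the same multiset of roots. As \<open>eigenvalues\<close> picks
  an unspecified enumeration, relations between the spectra of two matrices are obtained only up to
  a permutation.\<close>

lemma prod_linear_eq_imp_permutes:
  fixes y z :: "'n::finite \<Rightarrow> complex"
  assumes "\<And>x. (\<Prod>a\<in>UNIV. x - z a) = (\<Prod>a\<in>UNIV. x - y a)"
  obtains \<pi> where "\<pi> permutes UNIV" "z = y \<circ> \<pi>"
proof -
  have "poly (\<Prod>a\<in>UNIV. [:- z a, 1:]) = poly (\<Prod>a\<in>UNIV. [:- y a, 1:])"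
    using assms by (simp add: fun_eq_iff poly_prod)
  then have *: "proots (\<Prod>a\<in>UNIV. [:- z a, 1:]) = proots (\<Prod>a\<in>UNIV. [:- y a, 1:])"
    by (simp only: poly_eq_poly_eq_iff)
  have roots: "proots (\<Prod>a\<in>UNIV. [:- f a, 1:]) = image_mset f (mset_set UNIV)"
    for f :: "'n \<Rightarrow> complex"
  proof -
    have "(\<Sum>a\<in>S. {#f a#}) = image_mset f (mset_set S)" if "finite S" for S
      using that by (induction S rule: finite_induct) auto
    then show ?thesis by (subst proots_prod) simp_all
  qed
  obtain p where "p permutes UNIV" "\<forall>x\<in>UNIV. z x = y (p x)"
    using image_mset_eq_implies_permutes[of UNIV z y] * unfolding roots by auto
  then show ?thesis using that[of p] by (auto simp: fun_eq_iff)
qed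

lemma eigenvalues_adjoint:
  fixes A :: "complex^'n::finite^'n"
  obtains \<pi> where "\<pi> permutes UNIV" "eigenvalues (adjoint_matrix A) = (\<lambda>a. cnj (eigenvalues A a)) \<circ> \<pi>"
proof -
  have "det (mat x - adjoint_matrix A) = cnj (det (mat (cnj x) - A))" for x
  proof -
    have "mat x - adjoint_matrix A = map_matrix cnj (transpose (mat (cnj x) - A))"
      by (auto simp: vec_eq_iff mat_def adjoint_matrix_def map_matrix_def transpose_def)
    then show ?thesis by (simp add: cnj_det[symmetric])
  qed
  then have "(\<Prod>a\<in>UNIV. x - eigenvalues (adjoint_matrix A) a) = (\<Prod>a\<in>UNIV. x - cnj (eigenvalues A a))" for x
    by (simp add: charpoly_eigenvalues)
  then obtain \<pi> where "\<pi> permutes UNIV"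
      "eigenvalues (adjoint_matrix A) = (\<lambda>a. cnj (eigenvalues A a)) \<circ> \<pi>"
    by (rule prod_linear_eq_imp_permutes)
  then show ?thesis by (rule that)
qed

text \<open>For an eigenvector v, moving A to the other side of the inner product gives |z|^2 |v|^2
  = <Av, Av> = <v, v>.\<close>

lemma norm_eigenvalue_unitary:
  fixes A :: "complex^'n::finite^'n"
  assumes "A \<in> unitary_group"
  shows "norm (eigenvalues A a) = 1"
proof -
  define z where "z = eigenvalues A a"
  have "det (mat z - A) = 0"
    unfolding charpoly_eigenvalues z_def by (auto intro!: prod_zero bexI[of _ a])
  then have "\<not> invertible (mat z - A)" by (simp add: invertible_det_nz)
  then obtain v where v: "(mat z - A) *v v = 0" "v \<noteq> 0"
    by (auto simp: invertible_left_inverse matrix_left_invertible_ker)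
  have "mat z *v v = A *v v" using v(1) by (simp add: matrix_vector_mult_diff_rdistrib)
  moreover have "mat z *v v = (\<chi> i. z * v $ i)"
    by (simp add: vec_eq_iff matrix_vector_mult_def mat_def if_distrib[where f="\<lambda>x. x * _"] sum.delta' cong: if_cong)
  ultimately have Av: "(A *v v) $ i = z * v $ i" for i by (metis vec_lambda_beta)
  have "(\<Sum>i\<in>UNIV. cnj (z * v $ i) * (z * v $ i)) = (\<Sum>i\<in>UNIV. cnj ((A *v v) $ i) * (A *v v) $ i)"
    by (simp add: Av)
  also have "\<dots> = (\<Sum>i\<in>UNIV. \<Sum>j\<in>UNIV. cnj (v $ j) * (cnj (A $ i $ j) * (A *v v) $ i))"
  proof (rule sum.cong[OF refl])
    fix i
    have "cnj ((A *v v) $ i) = (\<Sum>j\<in>UNIV. cnj (v $ j) * cnj (A $ i $ j))"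
      by (simp add: matrix_vector_mult_def mult.commute)
    then show "cnj ((A *v v) $ i) * (A *v v) $ i =
        (\<Sum>j\<in>UNIV. cnj (v $ j) * (cnj (A $ i $ j) * (A *v v) $ i))"
      by (simp add: sum_distrib_right mult.assoc)
  qed
  also have "\<dots> = (\<Sum>j\<in>UNIV. cnj (v $ j) * ((adjoint_matrix A *v (A *v v)) $ j))"
  proof -
    have "(adjoint_matrix A *v w) $ j = (\<Sum>i\<in>UNIV. cnj (A $ i $ j) * w $ i)" for w j
      by (simp add: matrix_vector_mult_def adjoint_matrix_def map_matrix_def transpose_def)
    then show ?thesis by (subst sum.swap) (simp add: sum_distrib_left)
  qed
  also have "adjoint_matrix A *v (A *v v) = v"
    using assms by (simp add: matrix_vector_mul_assoc unitary_group_def)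
  finally have eq: "(norm z)\<^sup>2 * (\<Sum>i\<in>UNIV. (norm (v $ i))\<^sup>2) = (\<Sum>i\<in>UNIV. (norm (v $ i))\<^sup>2)"
  proof -
    assume *: "(\<Sum>i\<in>UNIV. cnj (z * v $ i) * (z * v $ i)) = (\<Sum>j\<in>UNIV. cnj (v $ j) * v $ j)"
    have n: "cnj w * w = of_real ((norm w)\<^sup>2)" for w
      by (metis complex_norm_square mult.commute)
    show ?thesis
      using * unfolding n of_real_sum[symmetric] of_real_eq_iff
      by (simp add: norm_mult power_mult_distrib sum_distrib_left)
  qed
  obtain i where "v $ i \<noteq> 0" using v(2) by (auto simp: vec_eq_iff)
  then have "0 < (\<Sum>i\<in>UNIV. (norm (v $ i))\<^sup>2)"
    by (intro sum_pos2[of _ i]) auto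
  with eq have "(norm z)\<^sup>2 = 1" by simp
  then show ?thesis
    using power2_eq_imp_eq[of "norm z" 1] by (simp add: z_def)
qed

section \<open>Inverses and adjoints of unitary matrices\<close>

lemma matrix_inv_unitary:
  assumes "A \<in> unitary_group"
  shows "matrix_inv A = adjoint_matrix A"
proof -
  have A: "A ** adjoint_matrix A = mat 1" "adjoint_matrix A ** A = mat 1"
    using assms by (auto simp: unitary_group_def)
  then have "\<exists>B. A ** B = mat 1 \<and> B ** A = mat 1" by blast
  then have "A ** matrix_inv A = mat 1 \<and> matrix_inv A ** A = mat 1"
    unfolding matrix_inv_def by (rule someI_ex)
  then have "adjoint_matrix A ** (A ** matrix_inv A) = adjoint_matrix A" by simp
  then have "(adjoint_matrix A ** A) ** matrix_inv A = adjoint_matrix A"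
    by (simp only: matrix_mul_assoc)
  then show ?thesis by (simp add: A)
qed

lemma adjoint_matrix_adjoint [simp]: "adjoint_matrix (adjoint_matrix A) = A"
  by (simp add: adjoint_matrix_def map_matrix_def transpose_def vec_eq_iff)

lemma adjoint_matrix_mult: "adjoint_matrix (A ** B) = adjoint_matrix B ** adjoint_matrix A"
  by (simp add: adjoint_matrix_def map_matrix_def transpose_def vec_eq_iff matrix_matrix_mult_def mult.commute)

lemma adjoint_unitary: "A \<in> unitary_group \<Longrightarrow> adjoint_matrix A \<in> unitary_group"
  by (simp add: unitary_group_def)

lemma continuous_adjoint_matrix: "continuous_on S adjoint_matrix"
  unfolding adjoint_matrix_def map_matrix_def transpose_def
  by (intro continuous_intros)

section \<open>Absolutely continuous functions\<close>

text \<open>Lets the total length of a division be compared with the measure of an open set that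
  contains its union.\<close>

lemma sum_content_division_eq:
  fixes \<D> :: "real set set"
  assumes "\<D> division_of S"
  shows "(\<Sum>K\<in>\<D>. measure lborel K) = measure lebesgue S" "S \<in> lmeasurable"
proof -
  show S: "S \<in> lmeasurable"
  proof -
    have "S = \<Union>\<D>" "finite \<D>" using assms by auto
    moreover have "compact K" if "K \<in> \<D>" for K
      using division_ofD(4)[OF assms that] by auto
    ultimately have "compact S" using compact_Union by auto
    then show ?thesis by (rule lmeasurable_compact)
  qed
  have "((\<lambda>x. 1::real) has_integral measure lborel K) K" if "K \<in> \<D>" for K
    using division_ofD(4)[OF assms that] by (metis has_integral_const_real has_integral_const mult.right_neutral real_scaleR_def)
  then have "((\<lambda>x. 1::real) has_integral (\<Sum>K\<in>\<D>. measure lborel K)) S"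
    by (rule has_integral_combine_division[OF assms])
  then show "(\<Sum>K\<in>\<D>. measure lborel K) = measure lebesgue S"
    using lmeasure_integral[OF S] by (simp add: integral_unique)
qed

text \<open>Henstock's argument: intervals tagged in the exceptional set have small total length, so
  absolute continuity controls their increments; at the other tags the derivative does.\<close>

lemma absolutely_continuous_has_integral:
  assumes ab: "a \<le> b" and ac: "absolutely_continuous_on {a..b} f" and E: "negligible E"
    and deriv: "\<And>t. t \<in> {a..b} - E \<Longrightarrow> (f has_vector_derivative g t) (at t within {a..b})"
  shows "(g has_integral f b - f a) {a..b}"
proof -
  \<comment> \<open>With the integrand set to 0 on \<open>E\<close>, an interval tagged in
    \<open>E\<close> contributes only the increment of \<open>f\<close>.\<close>
  define h where "h t = (if t \<in> E then 0 else g t)" for t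
  have "(h has_integral f b - f a) (cbox a b)"
    unfolding has_integral
  proof (intro allI impI)
    fix e :: real assume e: "e > 0"
    define e' where "e' = e / (2 * (b - a + 1))"
    have e': "e' > 0" "e' * (b - a) < e / 2" using e ab by (auto simp: e'_def field_simps)
    obtain \<delta> where \<delta>: "\<delta> > 0" and ac': "\<And>\<D>. \<D> division_of \<Union>\<D> \<Longrightarrow> \<Union>\<D> \<subseteq> {a..b} \<Longrightarrow>
        (\<Sum>K\<in>\<D>. measure lborel K) < \<delta> \<Longrightarrow> (\<Sum>K\<in>\<D>. norm (f (Sup K) - f (Inf K))) < e / 2"
      using ac e unfolding absolutely_continuous_on_def by (metis half_gt_zero)
    \<comment> \<open>The null set is enclosed in an open set shorter than the threshold of absolute
      continuity; the gauge will confine intervals tagged in \<open>E\<close> to it.\<close>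
    obtain T where T: "open T" "E \<subseteq> T" "T \<in> lmeasurable" "measure lebesgue T < \<delta>"
    proof -
      have nullE: "E \<in> null_sets lebesgue" using E by (simp add: negligible_iff_null_sets)
      then obtain T where T: "open T" "E \<subseteq> T" "T - E \<in> lmeasurable" "emeasure lebesgue (T - E) < ennreal \<delta>"
        using sets_lebesgue_outer_open[OF _ \<delta>] by blast
      have TE: "T = (T - E) \<union> E" using T(2) by auto
      have "T \<in> lmeasurable" using fmeasurable.Un[OF T(3) negligible_imp_measurable[OF E]] TE by simp
      moreover have "emeasure lebesgue T = emeasure lebesgue (T - E)"
        using T nullE by (simp add: emeasure_Diff_null_set)
      ultimately show ?thesis using that T \<delta>
        by (simp add: emeasure_eq_measure2 ennreal_less_iff)
    qed
    have "\<exists>d>0. \<forall>y\<in>{a..b}. \<bar>y - t\<bar> < d \<longrightarrow> norm (f y - f t - (y - t) *\<^sub>R g t) \<le> e' * \<bar>y - t\<bar>"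
      if "t \<in> {a..b} - E" for t
      using deriv[OF that] e'(1)
      unfolding has_vector_derivative_def has_derivative_within_alt by simp
    then obtain d where d: "\<And>t. t \<in> {a..b} - E \<Longrightarrow> d t > 0"
        "\<And>t y. t \<in> {a..b} - E \<Longrightarrow> y \<in> {a..b} \<Longrightarrow> \<bar>y - t\<bar> < d t \<Longrightarrow>
          norm (f y - f t - (y - t) *\<^sub>R g t) \<le> e' * \<bar>y - t\<bar>"
      by metis
    define \<gamma> where "\<gamma> t = (if t \<in> E then T else if t \<in> {a..b} then ball t (d t) else ball t 1)" for t
    have "gauge \<gamma>" unfolding gauge_def \<gamma>_def using T d by auto
    moreover have "norm ((\<Sum>(x,K)\<in>p. measure lborel K *\<^sub>R h x) - (f b - f a)) < e"
      if p: "p tagged_division_of cbox a b" and fine: "\<gamma> fine p" for p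
    proof -
      note pD = tagged_division_ofD[OF p]
      \<comment> \<open>\<open>Sup\<close> and \<open>Inf\<close> of the empty set are unspecified,
        while the passage from tagged intervals to the set of intervals needs the value 0 on
        degenerate boxes.\<close>
      define D where "D K = (if K = {} then 0 else norm (f (Sup K) - f (Inf K)))" for K
      define p1 where "p1 = {(x,K)\<in>p. x \<in> E}"
      define p2 where "p2 = {(x,K)\<in>p. x \<notin> E}"
      have p12: "p = p1 \<union> p2" "p1 \<inter> p2 = {}" by (auto simp: p1_def p2_def)
      have fin: "finite p1" "finite p2" using p12 pD(1) by (metis finite_Un)+
      define F where "F xK = measure lborel (snd xK) *\<^sub>R h (fst xK) - (f (Sup (snd xK)) - f (Inf (snd xK)))" for xK
      have "(\<Sum>(x,K)\<in>p. measure lborel K *\<^sub>R h x) - (f b - f a) = sum F p"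
        using additive_tagged_division_1[OF ab, of p f] p
        by (simp add: F_def sum_subtractf case_prod_unfold)
      also have "\<dots> = sum F p1 + sum F p2"
        using fin p12 by (simp add: sum.union_disjoint)
      finally have split: "(\<Sum>(x,K)\<in>p. measure lborel K *\<^sub>R h x) - (f b - f a) = sum F p1 + sum F p2" .
      have tp: "p1 tagged_partial_division_of cbox a b"
        using p by (rule tagged_partial_division_subset[OF tagged_division_of_def[THEN iffD1, THEN conjunct1]])
          (auto simp: p1_def)
      note div1 = partial_division_of_tagged_division[OF tp]
      have "norm (sum F p1) \<le> (\<Sum>(x,K)\<in>p1. D K)"
      proof (rule sum_norm_le, clarify)
        fix x K assume "(x,K) \<in> p1"
        then show "norm (F (x,K)) \<le> D K"
          using pD(2)[of x K] by (auto simp: F_def h_def p1_def D_def norm_minus_commute)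
      qed
      also have "\<dots> = (\<Sum>K\<in>snd ` p1. D K)"
      proof (rule sum.over_tagged_division_lemma[OF tagged_partial_division_of_Union_self[OF tp]])
        fix u v :: real assume "box u v = {}"
        then show "D (cbox u v) = 0" by (cases "u = v") (auto simp: D_def)
      qed
      also have "\<dots> = (\<Sum>K\<in>snd ` p1. norm (f (Sup K) - f (Inf K)))"
        using division_ofD(3)[OF div1] by (intro sum.cong) (auto simp: D_def)
      also have "\<dots> < e / 2"
      proof (rule ac')
        show "snd ` p1 division_of \<Union>(snd ` p1)" by (rule div1)
        show "\<Union>(snd ` p1) \<subseteq> {a..b}" using pD(3) by (force simp: p1_def)
        have "\<Union>(snd ` p1) \<subseteq> T"
          using fine by (force simp: p1_def \<gamma>_def fine_def)
        then have "measure lebesgue (\<Union>(snd ` p1)) \<le> measure lebesgue T"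
          using sum_content_division_eq(2)[OF div1] T by (intro measure_mono_fmeasurable) auto
        then show "(\<Sum>K\<in>snd ` p1. measure lborel K) < \<delta>"
          using sum_content_division_eq(1)[OF div1] T by simp
      qed
      finally have 1: "norm (sum F p1) < e / 2" .
      have "norm (sum F p2) \<le> (\<Sum>(x,K)\<in>p2. e' * measure lborel K)"
      proof (rule sum_norm_le, clarify)
        fix x K assume xK: "(x,K) \<in> p2"
        then have "(x,K) \<in> p" "x \<notin> E" by (auto simp: p2_def)
        with pD obtain u v where K: "K = cbox u v" "x \<in> cbox u v" "cbox u v \<subseteq> cbox a b" by metis
        have x: "x \<in> {a..b} - E" using K \<open>x \<notin> E\<close> by auto
        have "u \<le> x" "x \<le> v" and uvK: "u \<in> K" "v \<in> K" using K by auto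
        have "K \<subseteq> ball x (d x)"
          using fineD[OF fine \<open>(x,K) \<in> p\<close>] x by (simp add: \<gamma>_def)
        then have "\<bar>u - x\<bar> < d x" "\<bar>v - x\<bar> < d x"
          using uvK by (metis dist_commute dist_real_def mem_ball subsetD)+
        moreover have "u \<in> {a..b}" "v \<in> {a..b}"
          using uvK K by (metis box_real(2) subsetD)+
        ultimately have bu: "norm (f u - f x - (u - x) *\<^sub>R g x) \<le> e' * \<bar>u - x\<bar>"
            and bv: "norm (f v - f x - (v - x) *\<^sub>R g x) \<le> e' * \<bar>v - x\<bar>"
          using d(2)[OF x] by blast+
        \<comment> \<open>The increment is split at the tag, which lies between \<open>u\<close> and
          \<open>v\<close>, so that the two errors add up to \<open>e'\<close> times v - u.\<close>
        have "F (x,K) = (f u - f x - (u - x) *\<^sub>R g x) - (f v - f x - (v - x) *\<^sub>R g x)"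
          using K \<open>u \<le> x\<close> \<open>x \<le> v\<close> \<open>x \<notin> E\<close> by (simp add: F_def h_def algebra_simps)
        then have "norm (F (x,K)) \<le> e' * \<bar>u - x\<bar> + e' * \<bar>v - x\<bar>"
          using order_trans[OF norm_triangle_ineq4 add_mono[OF bu bv]] by simp
        then show "norm (F (x,K)) \<le> e' * measure lborel K"
          using K \<open>u \<le> x\<close> \<open>x \<le> v\<close> by (simp add: algebra_simps)
      qed
      also have "\<dots> \<le> (\<Sum>(x,K)\<in>p. e' * measure lborel K)"
        using pD(1) e' by (intro sum_mono2) (auto simp: p2_def)
      also have "\<dots> = e' * measure lborel (cbox a b)"
        using additive_content_tagged_division[OF p] by (simp add: sum_distrib_left[symmetric] case_prod_unfold)
      also have "\<dots> < e / 2" using e' ab by simp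
      finally have 2: "norm (sum F p2) < e / 2" .
      show ?thesis unfolding split using norm_triangle_ineq[of "sum F p1" "sum F p2"] 1 2 by linarith
    qed
    ultimately show "\<exists>\<gamma>. gauge \<gamma> \<and> (\<forall>\<D>. \<D> tagged_division_of cbox a b \<and> \<gamma> fine \<D> \<longrightarrow>
        norm ((\<Sum>(x, k)\<in>\<D>. measure lborel k *\<^sub>R h x) - (f b - f a)) < e)"
      by (intro exI[of _ \<gamma>] conjI allI impI) simp_all
  qed
  then show ?thesis
    using has_integral_spike[OF E, of "{a..b}" g h] by (auto simp: h_def)
qed

section \<open>Stability of absolute continuity\<close>

text \<open>One comparison serves three purposes: Lipschitz functions (C = 0), conjugates (C = 1, B
  = 0), and products with a character, where C = 1 and B comes from its Lipschitz constant.\<close>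

lemma absolutely_continuous_on_dominated:
  assumes f: "absolutely_continuous_on S f" and "C \<ge> 0" "B \<ge> 0"
    and le: "\<And>u v. u \<le> v \<Longrightarrow> u \<in> S \<Longrightarrow> v \<in> S \<Longrightarrow> norm (g v - g u) \<le> C * norm (f v - f u) + B * (v - u)"
  shows "absolutely_continuous_on S g"
  unfolding absolutely_continuous_on_def
proof (intro allI impI)
  fix e :: real assume e: "e > 0"
  have "e / (2 * (C + 1)) > 0" using e \<open>C \<ge> 0\<close> by simp
  then obtain \<delta> where \<delta>: "\<delta> > 0" "\<And>\<D>. \<D> division_of \<Union>\<D> \<Longrightarrow> \<Union>\<D> \<subseteq> S \<Longrightarrow>
      (\<Sum>K\<in>\<D>. measure lborel K) < \<delta> \<Longrightarrow> (\<Sum>K\<in>\<D>. norm (f (Sup K) - f (Inf K))) < e / (2 * (C + 1))"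
    using f unfolding absolutely_continuous_on_def by metis
  \<comment> \<open>Each of the two terms gets less than half of \<open>e\<close>; adding 1 to
    \<open>C\<close> and \<open>B\<close> makes this strict and avoids division by 0.\<close>
  define \<delta>' where "\<delta>' = min \<delta> (e / (2 * (B + 1)))"
  have "\<delta>' > 0" using \<delta> e \<open>B \<ge> 0\<close> by (simp add: \<delta>'_def)
  moreover have "(\<Sum>K\<in>\<D>. norm (g (Sup K) - g (Inf K))) < e"
    if D: "\<D> division_of \<Union>\<D>" "\<Union>\<D> \<subseteq> S" "(\<Sum>K\<in>\<D>. measure lborel K) < \<delta>'" for \<D>
  proof -
    have "(\<Sum>K\<in>\<D>. norm (g (Sup K) - g (Inf K))) \<le>
        (\<Sum>K\<in>\<D>. C * norm (f (Sup K) - f (Inf K)) + B * measure lborel K)"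
    proof (rule sum_mono)
      fix K assume K: "K \<in> \<D>"
      then obtain u v where uv: "K = cbox u v" using division_ofD(4)[OF D(1)] by blast
      then have "u \<le> v" using division_ofD(3)[OF D(1) K] by auto
      moreover have "K \<subseteq> S" using D(2) K by blast
      then have "u \<in> S" "v \<in> S" using uv \<open>u \<le> v\<close> by auto
      ultimately show "norm (g (Sup K) - g (Inf K)) \<le> C * norm (f (Sup K) - f (Inf K)) + B * measure lborel K"
        using le[of u v] uv by simp
    qed
    also have "\<dots> = C * (\<Sum>K\<in>\<D>. norm (f (Sup K) - f (Inf K))) + B * (\<Sum>K\<in>\<D>. measure lborel K)"
      by (simp add: sum.distrib sum_distrib_left)
    also have "\<dots> \<le> C * (e / (2 * (C + 1))) + B * (e / (2 * (B + 1)))"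
      using \<delta>(2)[OF D(1,2)] D(3) \<open>C \<ge> 0\<close> \<open>B \<ge> 0\<close>
      by (intro add_mono mult_left_mono) (auto simp: \<delta>'_def)
    also have "\<dots> < e / 2 + e / 2"
      using e \<open>C \<ge> 0\<close> \<open>B \<ge> 0\<close> by (intro add_strict_mono) (auto simp: field_simps add_pos_nonneg)
    finally show ?thesis by simp
  qed
  ultimately show "\<exists>\<delta>>0. \<forall>\<D>. \<D> division_of \<Union>\<D> \<and> \<Union>\<D> \<subseteq> S \<and> (\<Sum>K\<in>\<D>. measure lborel K) < \<delta>
      \<longrightarrow> (\<Sum>K\<in>\<D>. norm (g (Sup K) - g (Inf K))) < e"
    by (intro exI[of _ \<delta>'] conjI allI impI) simp_all
qed

lemma absolutely_continuous_on_lipschitz: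
  assumes "B \<ge> 0" "\<And>u v. u \<le> v \<Longrightarrow> u \<in> S \<Longrightarrow> v \<in> S \<Longrightarrow> norm (g v - g u) \<le> B * (v - u)"
  shows "absolutely_continuous_on S g"
proof (rule absolutely_continuous_on_dominated[where f="\<lambda>_. 0" and C=0 and B=B])
  show "absolutely_continuous_on S (\<lambda>_. 0)"
    unfolding absolutely_continuous_on_def by (auto intro: exI[of _ 1])
qed (use assms in auto)

text \<open>Conjugation on the circle reverses the angle. Reflection maps divisions to divisions of
  the same total length and only swaps the end points of each interval.\<close>

lemma absolutely_continuous_on_reflect:
  assumes f: "absolutely_continuous_on {0..c} f"
  shows "absolutely_continuous_on {0..c} (\<lambda>t. f (c - t))"
  unfolding absolutely_continuous_on_def
proof (intro allI impI)
  fix e :: real assume "e > 0"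
  then obtain \<delta> where \<delta>: "\<delta> > 0" "\<And>\<D>. \<D> division_of \<Union>\<D> \<Longrightarrow> \<Union>\<D> \<subseteq> {0..c} \<Longrightarrow>
      (\<Sum>K\<in>\<D>. measure lborel K) < \<delta> \<Longrightarrow> (\<Sum>K\<in>\<D>. norm (f (Sup K) - f (Inf K))) < e"
    using f unfolding absolutely_continuous_on_def by metis
  have "(\<Sum>K\<in>\<D>. norm (f (c - Sup K) - f (c - Inf K))) < e"
    if D: "\<D> division_of \<Union>\<D>" "\<Union>\<D> \<subseteq> {0..c}" "(\<Sum>K\<in>\<D>. measure lborel K) < \<delta>" for \<D>
  proof -
    define r where "r K = (\<lambda>t. c - t) ` K" for K
    have r: "r (cbox u v) = cbox (c - v) (c - u)" for u v
      by (simp add: r_def image_diff_atLeastAtMost)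
    have inj: "inj_on r \<D>" unfolding r_def by (intro inj_onI) (simp add: inj_image_eq_iff inj_on_def)
    have int: "interior (r K) = r (interior K)" for K
    proof -
      have "r K = (+) c ` (uminus ` K)" for K by (auto simp: r_def image_image)
      then show ?thesis by (simp add: interior_translation interior_negations)
    qed
    have div: "(r ` \<D>) division_of \<Union>(r ` \<D>)"
    proof (rule division_ofI)
      show "finite (r ` \<D>)" using D(1) by auto
      show "\<And>K. K \<in> r ` \<D> \<Longrightarrow> K \<subseteq> \<Union>(r ` \<D>)" by auto
      show "\<And>K. K \<in> r ` \<D> \<Longrightarrow> K \<noteq> {}" using division_ofD(3)[OF D(1)] by (auto simp: r_def)
      show "\<exists>a b. K = cbox a b" if "K \<in> r ` \<D>" for K
      proof -
        from that obtain L where L: "L \<in> \<D>" "K = r L" by blast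
        then obtain u v where "L = cbox u v" using division_ofD(4)[OF D(1)] by blast
        with L r show ?thesis by blast
      qed
      show "interior K1 \<inter> interior K2 = {}" if K: "K1 \<in> r ` \<D>" "K2 \<in> r ` \<D>" "K1 \<noteq> K2" for K1 K2
      proof -
        from K obtain L1 L2 where L: "L1 \<in> \<D>" "L2 \<in> \<D>" "L1 \<noteq> L2" "K1 = r L1" "K2 = r L2" by blast
        then have "interior L1 \<inter> interior L2 = {}" using division_ofD(5)[OF D(1)] by blast
        then show ?thesis unfolding L int by (auto simp: r_def)
      qed
    qed auto
    have ext: "Sup (r K) = c - Inf K \<and> Inf (r K) = c - Sup K \<and> measure lborel (r K) = measure lborel K" if K: "K \<in> \<D>" for K
    proof -
      obtain u v where uv: "K = cbox u v" using division_ofD(4)[OF D(1) K] by blast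
      then have "u \<le> v" using division_ofD(3)[OF D(1) K] by auto
      then show ?thesis unfolding uv r by simp
    qed
    have "\<Union>(r ` \<D>) \<subseteq> {0..c}" using D(2) by (force simp: r_def)
    moreover have "(\<Sum>K\<in>r ` \<D>. measure lborel K) < \<delta>"
      using D(3) ext by (simp add: sum.reindex[OF inj])
    ultimately have "(\<Sum>K\<in>r ` \<D>. norm (f (Sup K) - f (Inf K))) < e"
      by (rule \<delta>(2)[OF div])
    then show ?thesis
      using ext by (simp add: sum.reindex[OF inj] norm_minus_commute)
  qed
  with \<delta>(1) show "\<exists>\<delta>>0. \<forall>\<D>. \<D> division_of \<Union>\<D> \<and> \<Union>\<D> \<subseteq> {0..c} \<and> (\<Sum>K\<in>\<D>. measure lborel K) < \<delta>
      \<longrightarrow> (\<Sum>K\<in>\<D>. norm (f (c - Sup K) - f (c - Inf K))) < e"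
    by (intro exI[of _ \<delta>] conjI allI impI) simp_all
qed

section \<open>Haar measure on the circle\<close>

lemma measurable_cis_circle [measurable]: "cis \<in> measurable borel (restrict_space borel (sphere 0 1))"
proof (rule measurable_restrict_space2)
  have "continuous_on UNIV (\<lambda>t. cis t)" by (intro continuous_intros)
  then show "cis \<in> borel_measurable borel" by (rule borel_measurable_continuous_onI)
qed (simp add: Pi_iff)

lemma measurable_cis_uniform:
  "cis \<in> measurable (uniform_measure lborel {0..<2 * pi}) (restrict_space borel (sphere 0 1))"
proof -
  have "measurable (uniform_measure lborel {0..<2 * pi}) (restrict_space borel (sphere 0 1 :: complex set)) =
      measurable borel (restrict_space borel (sphere 0 1))"
    by (rule measurable_cong_sets) simp_all
  then show ?thesis using measurable_cis_circle by simp
qed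

lemma space_circle_haar [simp]: "space circle_haar = sphere 0 1"
  by (simp add: circle_haar_def space_restrict_space)

lemma sets_circle_haar [measurable_cong]: "sets circle_haar = sets (restrict_space borel (sphere 0 1))"
  by (simp add: circle_haar_def)

lemma prob_space_circle_haar: "prob_space circle_haar"
  unfolding circle_haar_def
  by (intro prob_space.prob_space_distr prob_space_uniform_measure measurable_cis_uniform)
    (auto simp: emeasure_lborel_Ico)

lemma borel_measurable_circle_haar_cis:
  assumes "f \<in> borel_measurable circle_haar"
  shows "(\<lambda>t. f (cis t)) \<in> borel_measurable borel"
proof -
  have "f \<in> borel_measurable (restrict_space borel (sphere 0 1))"
    using assms by (simp add: measurable_cong_sets[OF sets_circle_haar refl])
  then show ?thesis by measurable
qed

text \<open>The bridge from the Bochner integral on the circle to the gauge integral over the angle.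
  The factor 2 pi undoes the normalisation; the end point 2 pi is added as a null set.\<close>

lemma circle_haar_has_integral:
  fixes f :: "complex \<Rightarrow> complex"
  assumes "integrable circle_haar f"
  shows "((\<lambda>t. f (cis t)) has_integral (2 * pi) *\<^sub>R (LINT z|circle_haar. f z)) {0..2 * pi}"
proof -
  let ?U = "uniform_measure lborel {0..<2 * pi}"
  define g where "g t = (indicator {0..<2 * pi} t / (2 * pi) :: real)" for t
  have fc [measurable]: "(\<lambda>t. f (cis t)) \<in> borel_measurable borel"
    using assms by (intro borel_measurable_circle_haar_cis) auto
  have fm: "f \<in> borel_measurable (restrict_space borel (sphere 0 1))"
    using borel_measurable_integrable[OF assms] by (simp add: measurable_cong_sets[OF sets_circle_haar refl])
  have U: "?U = density lborel (\<lambda>t. ennreal (g t))"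
    unfolding uniform_measure_def g_def
    by (intro density_cong) (auto simp: emeasure_lborel_Ico divide_ennreal[symmetric] split: split_indicator)
  have g [measurable]: "g \<in> borel_measurable borel" unfolding g_def by auto
  have g0: "AE t in lborel. 0 \<le> g t" by (simp add: g_def)
  have "integrable ?U (\<lambda>t. f (cis t))"
    using assms fm measurable_cis_uniform unfolding circle_haar_def by (subst (asm) integrable_distr_eq) auto
  then have "integrable lborel (\<lambda>t. g t *\<^sub>R f (cis t))"
    unfolding U by (subst (asm) integrable_density) (auto simp: g0)
  moreover have "(LINT z|circle_haar. f z) = (LINT t|lborel. g t *\<^sub>R f (cis t))"
  proof -
    have "(LINT z|circle_haar. f z) = (LINT t|?U. f (cis t))"
      unfolding circle_haar_def by (rule integral_distr[OF measurable_cis_uniform fm])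
    also have "\<dots> = (LINT t|lborel. g t *\<^sub>R f (cis t))"
      unfolding U by (rule integral_density) (auto simp: g0)
    finally show ?thesis .
  qed
  ultimately have "((\<lambda>t. g t *\<^sub>R f (cis t)) has_integral (LINT z|circle_haar. f z)) UNIV"
    using has_integral_integral_lborel by metis
  then have "((\<lambda>t. (2 * pi) *\<^sub>R (g t *\<^sub>R f (cis t))) has_integral (2 * pi) *\<^sub>R (LINT z|circle_haar. f z)) UNIV"
    by (rule has_integral_cmul)
  also have "(\<lambda>t. (2 * pi) *\<^sub>R (g t *\<^sub>R f (cis t))) = (\<lambda>t. if t \<in> {0..<2 * pi} then f (cis t) else 0)"
    by (auto simp: g_def)
  finally have "((\<lambda>t. f (cis t)) has_integral (2 * pi) *\<^sub>R (LINT z|circle_haar. f z)) {0..<2 * pi}"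
    by (simp only: has_integral_restrict_UNIV)
  then show ?thesis
    by (rule iffD1[OF has_integral_spike_set_eq, rotated 2])
      (rule negligible_subset[of "{2 * pi}"]; force)+
qed

text \<open>Turns almost everywhere statements on the circle into exceptional sets for the gauge
  integral. Haar measure comes from a half-open interval, so 2 pi has to be put into the null set by
  hand.\<close>

lemma AE_circle_haar_negligible:
  assumes "AE z in circle_haar. P z"
  shows "negligible {t \<in> {0..2 * pi}. \<not> P (cis t)}"
proof -
  have "AE t in uniform_measure lborel {0..<2 * pi}. P (cis t)"
    using assms unfolding circle_haar_def by (rule AE_distrD[OF measurable_cis_uniform])
  then have "AE t in lborel. t \<in> {0..<2 * pi} \<longrightarrow> P (cis t)"
    by (subst (asm) AE_uniform_measure) (auto simp: emeasure_lborel_Ico)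
  then have "AE t in lebesgue. t \<in> {0..<2 * pi} \<longrightarrow> P (cis t)"
    by (rule AE_completion)
  then obtain N where "N \<in> null_sets lebesgue" "{t. \<not> (t \<in> {0..<2 * pi} \<longrightarrow> P (cis t))} \<subseteq> N"
    unfolding eventually_ae_filter by auto
  then have "negligible (insert (2 * pi) N)" "{t \<in> {0..2 * pi}. \<not> P (cis t)} \<subseteq> insert (2 * pi) N"
    by (auto simp: negligible_iff_null_sets[symmetric])
  then show ?thesis by (rule negligible_subset)
qed

lemma nn_integral_circle_haar:
  assumes "f \<in> borel_measurable circle_haar"
  shows "(\<integral>\<^sup>+z. f z \<partial>circle_haar) = (\<integral>\<^sup>+t. f (cis t) * indicator {0..<2 * pi} t \<partial>lborel) / ennreal (2 * pi)"
proof -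
  have fm: "f \<in> borel_measurable (restrict_space borel (sphere 0 1))"
    using assms by (simp add: measurable_cong_sets[OF sets_circle_haar refl])
  have [measurable]: "(\<lambda>t. f (cis t)) \<in> borel_measurable borel"
    using assms by (rule borel_measurable_circle_haar_cis)
  show ?thesis
    unfolding circle_haar_def
    by (subst nn_integral_distr[OF measurable_cis_uniform])
      (auto simp: fm nn_integral_uniform_measure emeasure_lborel_Ico)
qed

lemma measurable_cnj_circle [measurable]: "cnj \<in> measurable circle_haar circle_haar"
proof -
  have "cnj \<in> measurable (restrict_space borel (sphere 0 1)) (restrict_space borel (sphere 0 1))"
    by (intro measurable_restrict_space3) (auto intro: borel_measurable_continuous_onI continuous_intros)
  then show ?thesis by (simp add: measurable_cong_sets[OF sets_circle_haar sets_circle_haar])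
qed

text \<open>Conjugation is the substitution t -> 2 pi - t of the angle, which preserves Lebesgue
  measure.\<close>

lemma distr_circle_haar_cnj: "distr circle_haar circle_haar cnj = circle_haar"
proof (rule measure_eqI)
  fix A assume "A \<in> sets (distr circle_haar circle_haar cnj)"
  then have A: "A \<in> sets circle_haar" by simp
  define f :: "complex \<Rightarrow> ennreal" where "f = indicator A"
  have f: "f \<in> borel_measurable circle_haar" using A unfolding f_def by measurable
  then have fc: "(\<lambda>z. f (cnj z)) \<in> borel_measurable circle_haar" by measurable
  have [measurable]: "(\<lambda>t. f (cnj (cis t))) \<in> borel_measurable borel"
    using fc by (rule borel_measurable_circle_haar_cis)
  have "emeasure (distr circle_haar circle_haar cnj) A = (\<integral>\<^sup>+z. f z \<partial>distr circle_haar circle_haar cnj)"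
    using A by (simp add: f_def)
  also have "\<dots> = (\<integral>\<^sup>+z. f (cnj z) \<partial>circle_haar)"
    using f by (intro nn_integral_distr) auto
  also have "\<dots> = (\<integral>\<^sup>+t. f (cnj (cis t)) * indicator {0..<2 * pi} t \<partial>lborel) / ennreal (2 * pi)"
    by (rule nn_integral_circle_haar[OF fc])
  also have "(\<integral>\<^sup>+t. f (cnj (cis t)) * indicator {0..<2 * pi} t \<partial>lborel)
      = (\<integral>\<^sup>+t. f (cnj (cis (2 * pi - t))) * indicator {0..<2 * pi} (2 * pi - t) \<partial>lborel)"
    by (subst nn_integral_real_affine[where c="-1" and t="2 * pi"]) auto
  also have "\<dots> = (\<integral>\<^sup>+t. f (cis t) * indicator {0..<2 * pi} t \<partial>lborel)"
  proof (rule nn_integral_cong_AE)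
    \<comment> \<open>The reflection turns the interval closed at 0 into the one closed at 2 pi; the
      two differ only at these points.\<close>
    have "AE t in lborel. t \<noteq> 0" "AE t in lborel. t \<noteq> 2 * pi" by (auto intro: AE_lborel_singleton)
    then show "AE t in lborel. f (cnj (cis (2 * pi - t))) * indicator {0..<2 * pi} (2 * pi - t) =
        f (cis t) * indicator {0..<2 * pi} t"
    proof eventually_elim
      case (elim t)
      have "cnj (cis (2 * pi - t)) = cis t"
        by (simp add: complex_eq_iff cos_diff sin_diff)
      then show ?case using elim by (auto split: split_indicator)
    qed
  qed
  also have "\<dots> / ennreal (2 * pi) = (\<integral>\<^sup>+z. f z \<partial>circle_haar)"
    by (rule nn_integral_circle_haar[OF f, symmetric])
  also have "\<dots> = emeasure circle_haar A" using A by (simp add: f_def)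
  finally show "emeasure (distr circle_haar circle_haar cnj) A = emeasure circle_haar A" .
qed simp

lemma integral_circle_haar_cnj:
  fixes f :: "complex \<Rightarrow> complex"
  assumes "f \<in> borel_measurable circle_haar"
  shows "(LINT z|circle_haar. f (cnj z)) = (LINT z|circle_haar. f z)"
  using integral_distr[OF measurable_cnj_circle assms] by (simp add: distr_circle_haar_cnj)

lemma integrable_circle_haar_cnj:
  fixes f :: "complex \<Rightarrow> complex"
  assumes "integrable circle_haar f"
  shows "integrable circle_haar (\<lambda>z. f (cnj z))"
  using integrable_distr[OF measurable_cnj_circle, of f] assms by (simp add: distr_circle_haar_cnj)

lemma AE_circle_haar_cnj:
  assumes "AE z in circle_haar. P z"
  shows "AE z in circle_haar. P (cnj z)"
proof (rule AE_distrD[OF measurable_cnj_circle])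
  show "AE z in distr circle_haar circle_haar cnj. P z"
    using assms by (simp only: distr_circle_haar_cnj)
qed

lemma borel_measurable_circle_continuous:
  "continuous_on (sphere 0 1) f \<Longrightarrow> f \<in> borel_measurable circle_haar"
  unfolding measurable_cong_sets[OF sets_circle_haar refl]
  by (rule borel_measurable_continuous_on_restrict)

lemma integrable_circle_bounded_mult:
  fixes f g :: "complex \<Rightarrow> complex"
  assumes "integrable circle_haar f" "continuous_on (sphere 0 1) g"
  shows "integrable circle_haar (\<lambda>z. g z * f z)"
proof -
  have "compact (g ` sphere 0 1)" using assms(2) by (intro compact_continuous_image) auto
  then obtain B where B: "\<And>z. z \<in> sphere 0 1 \<Longrightarrow> norm (g z) \<le> B"
    using compact_imp_bounded bounded_iff by (metis imageI)
  have [measurable]: "g \<in> borel_measurable circle_haar" "f \<in> borel_measurable circle_haar"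
    using borel_measurable_circle_continuous[OF assms(2)] assms(1) by auto
  show ?thesis
  proof (rule Bochner_Integration.integrable_bound[where f="\<lambda>z. B * norm (f z)"])
    show "integrable circle_haar (\<lambda>z. B * norm (f z))" using assms(1) by auto
    show "AE z in circle_haar. norm (g z * f z) \<le> norm (B * norm (f z))"
      using AE_space
    proof eventually_elim
      case (elim z)
      then have "norm (g z) \<le> B" by (intro B) simp
      then show ?case
        by (auto simp: norm_mult abs_mult intro!: mult_right_mono)
    qed
  qed measurable
qed

lemma continuous_on_circle_powi: "continuous_on (sphere 0 1) (\<lambda>z::complex. z powi s)"
  by (intro continuous_intros) auto

section \<open>Differentiation along the circle\<close>

text \<open>The path z e^(it) never leaves the circle, so values elsewhere are irrelevant. This
  allows rewriting under \<open>zderiv\<close> with identities known only on the circle.\<close>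

lemma zderiv_cong_sphere:
  assumes "\<And>z. z \<in> sphere 0 1 \<Longrightarrow> f z = g z" "z \<in> sphere 0 1"
  shows "zderiv f z = zderiv g z" "circle_differentiable f z \<longleftrightarrow> circle_differentiable g z"
proof -
  have "(\<lambda>t. f (z * cis t)) = (\<lambda>t. g (z * cis t))"
    using assms by (auto simp: norm_mult)
  then show "zderiv f z = zderiv g z" "circle_differentiable f z \<longleftrightarrow> circle_differentiable g z"
    by (simp_all add: zderiv_def circle_differentiable_def)
qed

lemma circle_differentiable_has_vector_derivative:
  assumes "circle_differentiable f z"
  shows "((\<lambda>t. f (z * cis t)) has_vector_derivative \<i> * zderiv f z) (at 0)"
  using assms unfolding circle_differentiable_def zderiv_def
  by (subst (asm) vector_derivative_works) simp

lemma circle_differentiable_has_vector_derivative_cis: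
  assumes "circle_differentiable f (cis t)"
  shows "((\<lambda>u. f (cis u)) has_vector_derivative \<i> * zderiv f (cis t)) (at t)"
proof -
  have "((\<lambda>u. u - t) has_vector_derivative 1) (at t)" by (auto intro!: derivative_eq_intros)
  moreover have "((\<lambda>u. f (cis t * cis u)) has_vector_derivative \<i> * zderiv f (cis t)) (at (t - t))"
    using circle_differentiable_has_vector_derivative[OF assms] by simp
  ultimately have "(((\<lambda>u. f (cis t * cis u)) \<circ> (\<lambda>u. u - t)) has_vector_derivative
      1 *\<^sub>R (\<i> * zderiv f (cis t))) (at t)"
    by (rule vector_diff_chain_at)
  also have "(\<lambda>u. f (cis t * cis u)) \<circ> (\<lambda>u. u - t) = (\<lambda>u. f (cis u))"
    by (auto simp: cis_mult)
  finally show ?thesis by simp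
qed

lemma zderiv_eqI:
  assumes "((\<lambda>t. f (z * cis t)) has_vector_derivative d) (at 0)"
  shows "zderiv f z = - \<i> * d" "circle_differentiable f z"
  using assms unfolding zderiv_def circle_differentiable_def
  by (auto simp: vector_derivative_at intro: differentiableI_vector)

text \<open>Reversing the angle contributes the factor -1 and conjugating -i contributes another, so
  the signs cancel.\<close>

lemma zderiv_cnj_cnj:
  assumes "circle_differentiable f (cnj z)"
  shows "zderiv (\<lambda>z. cnj (f (cnj z))) z = cnj (zderiv f (cnj z))"
    and "circle_differentiable (\<lambda>z. cnj (f (cnj z))) z"
proof -
  have "((\<lambda>u::real. - u) has_vector_derivative - 1) (at 0)" by (auto intro!: derivative_eq_intros)
  moreover have "((\<lambda>t. f (cnj z * cis t)) has_vector_derivative \<i> * zderiv f (cnj z)) (at (- 0))"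
    using circle_differentiable_has_vector_derivative[OF assms] by simp
  ultimately have "(((\<lambda>t. f (cnj z * cis t)) \<circ> uminus) has_vector_derivative
      - 1 *\<^sub>R (\<i> * zderiv f (cnj z))) (at 0)"
    by (rule vector_diff_chain_at)
  then have "((\<lambda>t. cnj (f (cnj z * cis (- t)))) has_vector_derivative
      cnj (- 1 *\<^sub>R (\<i> * zderiv f (cnj z)))) (at 0)"
    by (intro has_vector_derivative_cnj) (simp add: o_def)
  then have *: "((\<lambda>t. cnj (f (cnj (z * cis t)))) has_vector_derivative
      cnj (- 1 *\<^sub>R (\<i> * zderiv f (cnj z)))) (at 0)"
    by (simp add: cis_cnj)
  show "zderiv (\<lambda>z. cnj (f (cnj z))) z = cnj (zderiv f (cnj z))"
    using zderiv_eqI(1)[OF *] by simp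
  show "circle_differentiable (\<lambda>z. cnj (f (cnj z))) z"
    using zderiv_eqI(2)[OF *] .
qed

lemma circle_differentiable_cnj_cnj:
  "circle_differentiable (\<lambda>z. cnj (f (cnj z))) z \<longleftrightarrow> circle_differentiable f (cnj z)"
  using zderiv_cnj_cnj(2)[of f z] zderiv_cnj_cnj(2)[of "\<lambda>z. cnj (f (cnj z))" "cnj z"] by auto

lemma sphere_cisE:
  assumes "z \<in> sphere (0::complex) 1"
  obtains t where "0 \<le> t" "t < 2 * pi" "z = cis t"
proof -
  obtain r t :: real where z: "z = complex_of_real r * (cos t + \<i> * sin t)" "0 \<le> r" "0 \<le> t" "t < 2 * pi"
    by (rule complex_split_polar[of z])
  have zc: "z = complex_of_real r * cis t" using z(1) by (simp add: complex_eq_iff)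
  then have "r = 1" using assms z(2) by (simp add: norm_mult)
  then show ?thesis using that z zc by simp
qed

lemma continuous_on_circle_cis:
  assumes "continuous_on (sphere 0 1) f"
  shows "continuous_on S (\<lambda>t. f (cis t))"
proof -
  have "continuous_on S (\<lambda>t. cis t)" by (intro continuous_intros)
  then show ?thesis
    by (rule continuous_on_compose2[OF assms]) auto
qed

lemma continuous_on_circle_bounded:
  fixes f :: "complex \<Rightarrow> complex"
  assumes "continuous_on (sphere 0 1) f"
  obtains B where "B \<ge> 0" "\<And>t. norm (f (cis t)) \<le> B"
proof -
  have "compact (f ` sphere 0 1)" using assms by (intro compact_continuous_image) auto
  then obtain B where B: "\<And>z. z \<in> sphere 0 1 \<Longrightarrow> norm (f z) \<le> B"
    using compact_imp_bounded bounded_iff by (metis imageI)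
  then have "norm (f (cis t)) \<le> B" for t by simp
  moreover from this have "B \<ge> 0" using norm_ge_zero order_trans by blast
  ultimately show ?thesis using that by blast
qed

lemma vector_derivative_bound_lipschitz:
  fixes f :: "real \<Rightarrow> complex"
  assumes "\<And>t. (f has_vector_derivative g t) (at t)" "\<And>t. norm (g t) \<le> B" "u \<le> v"
  shows "norm (f v - f u) \<le> B * (v - u)"
proof -
  have "norm (f v - f u) \<le> B * norm (v - u)"
  proof (rule differentiable_bound[of UNIV f "\<lambda>t h. h *\<^sub>R g t"])
    show "(f has_derivative (\<lambda>h. h *\<^sub>R g t)) (at t within UNIV)" for t
      using assms(1) by (simp add: has_vector_derivative_def)
    show "onorm (\<lambda>h. h *\<^sub>R g t) \<le> B" for t
    proof (rule onorm_le)
      show "norm (h *\<^sub>R g t) \<le> B * norm h" for h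
        using mult_left_mono[OF assms(2)[of t], of "\<bar>h\<bar>"] by (simp add: mult.commute)
    qed
  qed auto
  then show ?thesis using assms(3) by simp
qed

lemma circle_differentiable_imp_absolutely_continuous:
  assumes "\<And>z. z \<in> sphere 0 1 \<Longrightarrow> circle_differentiable f z" "continuous_on (sphere 0 1) (zderiv f)"
  shows "absolutely_continuous_on S (\<lambda>t. f (cis t))"
proof -
  obtain B where B: "B \<ge> 0" "\<And>t. norm (zderiv f (cis t)) \<le> B"
    using continuous_on_circle_bounded[OF assms(2)] by blast
  have "norm (f (cis v) - f (cis u)) \<le> B * (v - u)" if "u \<le> v" for u v
    by (rule vector_derivative_bound_lipschitz[OF circle_differentiable_has_vector_derivative_cis _ that])
      (use assms B in \<open>auto simp: norm_mult\<close>)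
  then show ?thesis by (intro absolutely_continuous_on_lipschitz[OF B(1)])
qed

text \<open>Integration by parts: e^(ist) f(e^(it)) is absolutely continuous in t, and the integral
  of its derivative over a full period is 0.\<close>

lemma circle_transform_zderiv:
  assumes int: "integrable circle_haar f" "integrable circle_haar (zderiv f)"
    and cont: "continuous_on (sphere 0 1) f"
    and ac: "absolutely_continuous_on {0..2 * pi} (\<lambda>t. f (cis t))"
    and diff: "AE z in circle_haar. circle_differentiable f z"
  shows "circle_transform (zderiv f) s = - of_int s * circle_transform f s"
proof -
  define g where "g t = cis (of_int s * t) * f (cis t)" for t
  define g' where "g' t = cis (of_int s * t) * (\<i> * zderiv f (cis t)) + (\<i> * of_int s * cis (of_int s * t)) * f (cis t)" for t
  have dcis: "((\<lambda>t. cis (of_int s * t)) has_vector_derivative \<i> * of_int s * cis (of_int s * t)) (at t)" for t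
    unfolding has_vector_derivative_def
    by (auto intro!: derivative_eq_intros simp: scaleR_conv_of_real algebra_simps)
  obtain B where B: "B \<ge> 0" "\<And>t. norm (f (cis t)) \<le> B"
    using continuous_on_circle_bounded[OF cont] by blast
  have "absolutely_continuous_on {0..2 * pi} g"
  proof (rule absolutely_continuous_on_dominated[OF ac, of 1 "\<bar>of_int s\<bar> * B"])
    fix u v :: real assume uv: "u \<le> v"
    have "g v - g u = cis (of_int s * v) * (f (cis v) - f (cis u)) + (cis (of_int s * v) - cis (of_int s * u)) * f (cis u)"
      by (simp add: g_def algebra_simps)
    also have "norm \<dots> \<le> norm (f (cis v) - f (cis u)) + norm (cis (of_int s * v) - cis (of_int s * u)) * norm (f (cis u))"
      by (rule order_trans[OF norm_triangle_ineq]) (simp add: norm_mult)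
    also have "norm (cis (of_int s * v) - cis (of_int s * u)) \<le> \<bar>of_int s\<bar> * (v - u)"
      by (rule vector_derivative_bound_lipschitz[OF dcis _ uv]) (simp add: norm_mult)
    then have "norm (cis (of_int s * v) - cis (of_int s * u)) * norm (f (cis u)) \<le> \<bar>of_int s\<bar> * (v - u) * B"
      using B uv by (intro mult_mono) auto
    finally show "norm (g v - g u) \<le> 1 * norm (f (cis v) - f (cis u)) + \<bar>of_int s\<bar> * B * (v - u)"
      by (simp add: algebra_simps)
  qed (use B in auto)
  then have "(g' has_integral g (2 * pi) - g 0) {0..2 * pi}"
  proof (rule absolutely_continuous_has_integral[rotated])
    show "negligible {t \<in> {0..2 * pi}. \<not> circle_differentiable f (cis t)}"
      by (rule AE_circle_haar_negligible[OF diff])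
    fix t assume "t \<in> {0..2 * pi} - {t \<in> {0..2 * pi}. \<not> circle_differentiable f (cis t)}"
    then have "circle_differentiable f (cis t)" by auto
    from has_vector_derivative_mult[OF dcis[of t] circle_differentiable_has_vector_derivative_cis[OF this]]
    show "(g has_vector_derivative g' t) (at t within {0..2 * pi})"
      unfolding g_def g'_def by (rule has_vector_derivative_at_within)
  qed simp
  \<comment> \<open>This is where s being an integer matters.\<close>
  moreover have "g (2 * pi) = g 0"
  proof -
    have "cis (of_int s * (2 * pi)) = 1"
      using cis_multiple_2pi[of "of_int s"] by (simp add: mult.commute)
    then show ?thesis by (simp add: g_def)
  qed
  ultimately have 0: "(g' has_integral 0) {0..2 * pi}" by simp
  have tr: "((\<lambda>t. cis (of_int s * t) * h (cis t)) has_integral (2 * pi) *\<^sub>R circle_transform h s) {0..2 * pi}"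
    if "integrable circle_haar h" for h
    using circle_haar_has_integral[OF integrable_circle_bounded_mult[OF that continuous_on_circle_powi[of s]]]
    by (simp add: circle_transform_def cis_power_int)
  have "((\<lambda>t. \<i> * (cis (of_int s * t) * zderiv f (cis t)) + (\<i> * of_int s) * (cis (of_int s * t) * f (cis t))) has_integral
      \<i> * ((2 * pi) *\<^sub>R circle_transform (zderiv f) s) + (\<i> * of_int s) * ((2 * pi) *\<^sub>R circle_transform f s)) {0..2 * pi}"
    by (intro has_integral_add has_integral_mult_right tr int)
  moreover have "(\<lambda>t. \<i> * (cis (of_int s * t) * zderiv f (cis t)) + (\<i> * of_int s) * (cis (of_int s * t) * f (cis t))) = g'"
    by (auto simp: g'_def algebra_simps)
  ultimately have "\<i> * ((2 * pi) *\<^sub>R circle_transform (zderiv f) s) + (\<i> * of_int s) * ((2 * pi) *\<^sub>R circle_transform f s) = 0"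
    using 0 has_integral_unique by metis
  then have "(\<i> * (2 * pi)) * (circle_transform (zderiv f) s + of_int s * circle_transform f s) = 0"
    by (simp add: scaleR_conv_of_real algebra_simps)
  then have "circle_transform (zderiv f) s + of_int s * circle_transform f s = 0" by simp
  then show ?thesis by (simp add: eq_neg_iff_add_eq_0)
qed

text \<open>Absolute continuity is part of the definition for order \<open>N - 2\<close> only; below
  it, a continuous next derivative on the compact circle gives a Lipschitz bound.\<close>

lemma L1_diff_zderiv:
  assumes w: "w \<in> L1_diff N" and j: "j < N - 1"
  shows "continuous_on (sphere 0 1) ((zderiv ^^ j) w)"
    and "absolutely_continuous_on {0..2 * pi} (\<lambda>t. (zderiv ^^ j) w (cis t))"
    and "AE z in circle_haar. circle_differentiable ((zderiv ^^ j) w) z"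
proof -
  have N: "N \<ge> 2" using j by simp
  note * = w[unfolded L1_diff_def, simplified, THEN conjunct2, THEN conjunct2, rule_format, OF N]
  show "continuous_on (sphere 0 1) ((zderiv ^^ j) w)" using * j by auto
  show "absolutely_continuous_on {0..2 * pi} (\<lambda>t. (zderiv ^^ j) w (cis t))"
  proof (cases "j = N - 2")
    case False
    then have "j < N - 2" "Suc j \<le> N - 2" using j by auto
    then have "continuous_on (sphere 0 1) ((zderiv ^^ Suc j) w)"
      "\<And>z. z \<in> sphere 0 1 \<Longrightarrow> circle_differentiable ((zderiv ^^ j) w) z" using * by auto
    then show ?thesis by (intro circle_differentiable_imp_absolutely_continuous) auto
  qed (use * in auto)
  show "AE z in circle_haar. circle_differentiable ((zderiv ^^ j) w) z"
  proof (cases "j = N - 2")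
    case False
    then have "j < N - 2" using j by auto
    then have "\<And>z. z \<in> space circle_haar \<Longrightarrow> circle_differentiable ((zderiv ^^ j) w) z" using * by auto
    then show ?thesis by (rule AE_I2)
  qed (use * in auto)
qed

lemma L1_diff_integrable:
  assumes "w \<in> L1_diff N" "j \<le> N - 1"
  shows "integrable circle_haar ((zderiv ^^ j) w)"
  using assms by (simp add: L1_diff_def)

lemma circle_transform_zderiv_power:
  assumes w: "w \<in> L1_diff N" and "j \<le> N - 1"
  shows "circle_transform ((zderiv ^^ j) w) s = (- of_int s) ^ j * circle_transform w s"
  using \<open>j \<le> N - 1\<close>
proof (induction j)
  case (Suc j)
  then have j: "j < N - 1" by simp
  have "circle_transform (zderiv ((zderiv ^^ j) w)) s = - of_int s * circle_transform ((zderiv ^^ j) w) s"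
    using L1_diff_zderiv[OF w j] L1_diff_integrable[OF w, of j] L1_diff_integrable[OF w, of "Suc j"] j
    by (intro circle_transform_zderiv) auto
  then show ?case using Suc by simp
qed simp

lemma zderiv_cmult:
  assumes "circle_differentiable f z"
  shows "zderiv (\<lambda>z. c * f z) z = c * zderiv f z"
  using zderiv_eqI(1)[OF has_vector_derivative_mult_right[OF circle_differentiable_has_vector_derivative[OF assms]]]
  by (simp add: algebra_simps)

text \<open>The identity can only be expected almost everywhere: where \<open>f\<close> is not differentiable,
  \<open>zderiv f\<close> and \<open>zderiv (- f)\<close> are the same unspecified constant.\<close>

lemma AE_funpow_uminus_zderiv:
  assumes w: "w \<in> L1_diff N" and k: "k \<le> N - 1"
  shows "AE z in circle_haar. ((\<lambda>f x. - zderiv f x) ^^ k) w z = (- 1) ^ k * (zderiv ^^ k) w z"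
proof (cases k)
  case (Suc m)
  have N: "N \<ge> 2" using k Suc by simp
  have dif: "circle_differentiable ((zderiv ^^ j) w) z" if "j < N - 2" "z \<in> sphere 0 1" for j z
    using w that unfolding L1_diff_def by simp
  have sph: "((\<lambda>f x. - zderiv f x) ^^ j) w z = (- 1) ^ j * (zderiv ^^ j) w z"
    if "j \<le> N - 2" "z \<in> sphere 0 1" for j z
    using that
  proof (induction j arbitrary: z)
    case (Suc j)
    have "zderiv (((\<lambda>f x. - zderiv f x) ^^ j) w) z = zderiv (\<lambda>z. (- 1) ^ j * (zderiv ^^ j) w z) z"
      using Suc by (intro zderiv_cong_sphere) auto
    also have "\<dots> = (- 1) ^ j * zderiv ((zderiv ^^ j) w) z"
      using Suc by (intro zderiv_cmult dif) auto
    finally show ?case by simp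
  qed simp
  have "m < N - 1" "m \<le> N - 2" using k Suc by auto
  from L1_diff_zderiv(3)[OF w this(1)] show ?thesis
    using AE_space
  proof eventually_elim
    case (elim z)
    then have z: "z \<in> sphere 0 1" by simp
    have "zderiv (((\<lambda>f x. - zderiv f x) ^^ m) w) z = zderiv (\<lambda>z. (- 1) ^ m * (zderiv ^^ m) w z) z"
      using sph[OF \<open>m \<le> N - 2\<close>] z by (intro zderiv_cong_sphere) auto
    also have "\<dots> = (- 1) ^ m * zderiv ((zderiv ^^ m) w) z"
      by (rule zderiv_cmult[OF elim(1)])
    finally show ?case by (simp add: Suc)
  qed
qed simp

section \<open>Measurability of the derivative along the circle\<close>

text \<open>The Cauchy criterion for difference quotients with denominators cleared. Restricting
  increments to rationals and tolerances to 1/(n + 1) leaves only countable quantifiers, as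
  measurability in z requires; continuity of \<open>F\<close> recovers real increments.\<close>

lemma circle_differentiable_iff_Cauchy:
  fixes z :: complex and f :: "complex \<Rightarrow> complex"
  defines "F \<equiv> \<lambda>t. f (z * cis t)"
  assumes cont: "continuous_on UNIV F"
  shows "circle_differentiable f z \<longleftrightarrow>
    (\<forall>n. \<exists>m. \<forall>p q :: rat. \<bar>real_of_rat p\<bar> < 1 / Suc m \<longrightarrow> \<bar>real_of_rat q\<bar> < 1 / Suc m \<longrightarrow>
      norm (real_of_rat q *\<^sub>R (F (of_rat p) - F 0) - real_of_rat p *\<^sub>R (F (of_rat q) - F 0))
        \<le> \<bar>real_of_rat p\<bar> * \<bar>real_of_rat q\<bar> / Suc n)" (is "_ \<longleftrightarrow> ?C")
proof
  assume "circle_differentiable f z"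
  then obtain L where L: "(F has_vector_derivative L) (at 0)"
    unfolding circle_differentiable_def F_def by (auto simp: vector_derivative_works)
  show ?C
  proof
    fix n :: nat
    define e where "e = 1 / (2 * real (Suc n))"
    have "e > 0" by (simp add: e_def)
    then obtain d where d: "d > 0" "\<And>y. \<bar>y\<bar> < d \<Longrightarrow> norm (F y - F 0 - y *\<^sub>R L) \<le> e * \<bar>y\<bar>"
      using L unfolding has_vector_derivative_def has_derivative_within_alt by force
    obtain m where m: "1 / real (Suc m) < d" using d(1) nat_approx_posE by blast
    have core: "norm (q *\<^sub>R (F p - F 0) - p *\<^sub>R (F q - F 0)) \<le> \<bar>p\<bar> * \<bar>q\<bar> / Suc n"
      if "\<bar>p\<bar> < 1 / Suc m" "\<bar>q\<bar> < 1 / Suc m" for p q :: real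
    proof -
      have "q *\<^sub>R (F p - F 0) - p *\<^sub>R (F q - F 0) = q *\<^sub>R (F p - F 0 - p *\<^sub>R L) - p *\<^sub>R (F q - F 0 - q *\<^sub>R L)"
        by (simp add: algebra_simps)
      also have "norm \<dots> \<le> \<bar>q\<bar> * norm (F p - F 0 - p *\<^sub>R L) + \<bar>p\<bar> * norm (F q - F 0 - q *\<^sub>R L)"
        by (rule order_trans[OF norm_triangle_ineq4]) simp
      also have "\<dots> \<le> \<bar>q\<bar> * (e * \<bar>p\<bar>) + \<bar>p\<bar> * (e * \<bar>q\<bar>)"
        using that m by (intro add_mono mult_left_mono d(2)) auto
      also have "\<dots> = \<bar>p\<bar> * \<bar>q\<bar> * (e + e)" by (simp add: algebra_simps)
      also have "e + e = 1 / Suc n" by (simp add: e_def field_simps)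
      also have "\<bar>p\<bar> * \<bar>q\<bar> * (1 / Suc n) = \<bar>p\<bar> * \<bar>q\<bar> / Suc n" by simp
      finally show ?thesis .
    qed
    then show "\<exists>m. \<forall>p q :: rat. \<bar>real_of_rat p\<bar> < 1 / Suc m \<longrightarrow> \<bar>real_of_rat q\<bar> < 1 / Suc m \<longrightarrow>
      norm (real_of_rat q *\<^sub>R (F (of_rat p) - F 0) - real_of_rat p *\<^sub>R (F (of_rat q) - F 0))
        \<le> \<bar>real_of_rat p\<bar> * \<bar>real_of_rat q\<bar> / Suc n"
      by (intro exI[of _ m] allI impI core)
  qed
next
  assume C: ?C
  define Q where "Q n m \<longleftrightarrow> (\<forall>p q :: rat. \<bar>real_of_rat p\<bar> < 1 / Suc m \<longrightarrow> \<bar>real_of_rat q\<bar> < 1 / Suc m \<longrightarrow>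
      norm (real_of_rat q *\<^sub>R (F (of_rat p) - F 0) - real_of_rat p *\<^sub>R (F (of_rat q) - F 0))
        \<le> \<bar>real_of_rat p\<bar> * \<bar>real_of_rat q\<bar> / Suc n)" for n m
  have exQ: "\<exists>m. Q n m" for n using C unfolding Q_def by (rule spec)
  \<comment> \<open>The derivative is found as the limit of the difference quotients
    \<open>x k\<close> along the rational increments 1/(k + 1).\<close>
  define y where "y k = (1 / real (Suc k))" for k
  define x where "x k = (1 / y k) *\<^sub>R (F (y k) - F 0)" for k
  have y: "y k > 0" "y k = real_of_rat (1 / of_nat (Suc k))" for k
    by (simp_all add: y_def of_rat_divide of_rat_add)
  have ylim: "y \<longlonglongrightarrow> 0" unfolding y_def by (rule LIMSEQ_Suc[OF lim_inverse_n'])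
  have bound: "norm ((F p - F 0) - p *\<^sub>R x k) \<le> \<bar>p\<bar> / Suc n"
    if m: "Q n m"
      and p: "p \<in> \<rat>" "\<bar>p\<bar> < 1 / Suc m" and k: "k > m" for m n p k
  proof -
    obtain p' where p': "p = of_rat p'" using p(1) by (auto elim: Rats_cases)
    have "y k < 1 / Suc m" using k by (simp add: y_def frac_less2)
    then have "norm (y k *\<^sub>R (F p - F 0) - p *\<^sub>R (F (y k) - F 0)) \<le> \<bar>p\<bar> * y k / Suc n"
      using m[unfolded Q_def, rule_format, of p' "1 / of_nat (Suc k)"] y[of k] p(2) unfolding p' by simp
    moreover have "y k *\<^sub>R (F p - F 0) - p *\<^sub>R (F (y k) - F 0) = y k *\<^sub>R ((F p - F 0) - p *\<^sub>R x k)"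
      using y(1)[of k] by (simp add: x_def algebra_simps)
    ultimately have "y k * norm ((F p - F 0) - p *\<^sub>R x k) \<le> y k * (\<bar>p\<bar> / Suc n)"
      using y(1)[of k] by (simp add: mult.commute)
    then show ?thesis using y(1)[of k] by (simp only: mult_le_cancel_left_pos)
  qed
  have "Cauchy x"
  proof (rule CauchyI')
    fix e :: real assume "e > 0"
    then obtain n where n: "1 / real (Suc n) < e" using nat_approx_posE by blast
    obtain m where m: "Q n m" using exQ by blast
    have "dist (x l) (x k) < e" if "l > m" "k > l" for l k
    proof -
      have "y l < 1 / Suc m" using that by (simp add: y_def frac_less2)
      then have "norm ((F (y l) - F 0) - y l *\<^sub>R x k) \<le> y l / Suc n"
        using bound[OF m, of "y l" k] y[of l] that by simp
      moreover have "(F (y l) - F 0) - y l *\<^sub>R x k = y l *\<^sub>R (x l - x k)"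
        using y(1)[of l] by (simp add: x_def algebra_simps)
      ultimately have "y l * norm (x l - x k) \<le> y l * (1 / Suc n)"
        using y(1)[of l] by simp
      then have "norm (x l - x k) \<le> 1 / Suc n"
        using y(1)[of l] by (simp only: mult_le_cancel_left_pos)
      then show ?thesis using n by (simp add: dist_norm)
    qed
    then show "\<exists>M. \<forall>m\<ge>M. \<forall>n>m. dist (x m) (x n) < e"
      by (intro exI[of _ "Suc m"]) auto
  qed
  then obtain L where L: "x \<longlonglongrightarrow> L" using Cauchy_convergent convergent_def by blast
  have "(F has_vector_derivative L) (at 0)"
    unfolding has_vector_derivative_def has_derivative_within_alt
  proof (intro conjI allI impI)
    fix e :: real assume "e > 0"
    then obtain n where n: "1 / real (Suc n) < e" using nat_approx_posE by blast
    obtain m where m: "Q n m" using exQ by blast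
    \<comment> \<open>\<open>G\<close> measures by how much the desired estimate fails. It is
      continuous, so a failure at a real increment would spread to a nearby rational one, where the
      estimate is already known.\<close>
    define G where "G h = norm (F h - F 0 - h *\<^sub>R L) - \<bar>h\<bar> / Suc n" for h
    have rat: "G p \<le> 0" if "p \<in> \<rat>" "\<bar>p\<bar> < 1 / Suc m" for p
    proof -
      have "(\<lambda>k. norm ((F p - F 0) - p *\<^sub>R x k)) \<longlonglongrightarrow> norm ((F p - F 0) - p *\<^sub>R L)"
        by (intro tendsto_intros L)
      moreover have "\<forall>\<^sub>F k in sequentially. norm ((F p - F 0) - p *\<^sub>R x k) \<le> \<bar>p\<bar> / Suc n"
        using bound[OF m that] by (auto intro!: eventually_sequentiallyI[of "Suc m"])
      ultimately have "norm ((F p - F 0) - p *\<^sub>R L) \<le> \<bar>p\<bar> / Suc n"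
        by (rule tendsto_upperbound) simp
      then show ?thesis by (simp add: G_def)
    qed
    have "continuous_on UNIV G" unfolding G_def by (intro continuous_intros cont) auto
    then have opn: "open ({h. G h > 0} \<inter> {h. \<bar>h\<bar> < 1 / Suc m})"
      by (intro open_Int open_Collect_less continuous_intros) auto
    have "G h \<le> 0" if "\<bar>h\<bar> < 1 / Suc m" for h
    proof (rule ccontr)
      assume "\<not> G h \<le> 0"
      with that have "h \<in> {h. G h > 0} \<inter> {h. \<bar>h\<bar> < 1 / Suc m}" by simp
      then obtain d where d: "d > 0" "ball h d \<subseteq> {h. G h > 0} \<inter> {h. \<bar>h\<bar> < 1 / Suc m}"
        by (rule openE[OF opn])
      obtain r where r: "r \<in> \<rat>" "h < r" "r < h + d" using Rats_dense_in_real[of h "h + d"] d(1) by auto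
      then have "r \<in> ball h d" by (simp add: dist_norm)
      then have "G r > 0" "\<bar>r\<bar> < 1 / Suc m" using d(2) by auto
      then show False using rat[OF r(1)] by simp
    qed
    note G_le = this
    have "norm (F h - F 0 - h *\<^sub>R L) \<le> e * \<bar>h\<bar>" if "\<bar>h\<bar> < 1 / Suc m" for h
    proof -
      have "norm (F h - F 0 - h *\<^sub>R L) \<le> (1 / Suc n) * \<bar>h\<bar>"
        using G_le[OF that] by (simp add: G_def)
      also have "\<dots> \<le> e * \<bar>h\<bar>" using n by (intro mult_right_mono) auto
      finally show ?thesis .
    qed
    then show "\<exists>d>0. \<forall>y\<in>UNIV. norm (y - 0) < d \<longrightarrow> norm (F y - F 0 - (y - 0) *\<^sub>R L) \<le> e * norm (y - 0)"
      by (intro exI[of _ "1 / Suc m"]) auto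
  qed (rule bounded_linear_scaleR_left)
  then show "circle_differentiable f z"
    unfolding circle_differentiable_def F_def by (rule differentiableI_vector)
qed

lemma continuous_on_circle_rotate:
  assumes "continuous_on (sphere 0 1) f" "z \<in> sphere (0::complex) 1"
  shows "continuous_on UNIV (\<lambda>t. f (z * cis t))"
  by (rule continuous_on_compose2[OF assms(1)])
    (use assms(2) in \<open>auto intro!: continuous_intros simp: norm_mult\<close>)

lemma sets_circle_differentiable:
  fixes f :: "complex \<Rightarrow> complex"
  assumes f: "continuous_on (sphere 0 1) f"
  shows "{z \<in> space circle_haar. circle_differentiable f z} \<in> sets circle_haar"
proof -
  have rot [measurable]: "(\<lambda>z. f (z * cis t)) \<in> borel_measurable circle_haar" for t
    by (intro borel_measurable_circle_continuous continuous_on_compose2[OF f])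
      (auto intro!: continuous_intros simp: norm_mult)
  have "{z \<in> space circle_haar. \<forall>n. \<exists>m. \<forall>p q :: rat. \<bar>real_of_rat p\<bar> < 1 / Suc m \<longrightarrow>
      \<bar>real_of_rat q\<bar> < 1 / Suc m \<longrightarrow>
      norm (real_of_rat q *\<^sub>R (f (z * cis (of_rat p)) - f (z * cis 0)) - real_of_rat p *\<^sub>R (f (z * cis (of_rat q)) - f (z * cis 0)))
        \<le> \<bar>real_of_rat p\<bar> * \<bar>real_of_rat q\<bar> / Suc n} \<in> sets circle_haar"
    by measurable
  also have "{z \<in> space circle_haar. \<forall>n. \<exists>m. \<forall>p q :: rat. \<bar>real_of_rat p\<bar> < 1 / Suc m \<longrightarrow>
      \<bar>real_of_rat q\<bar> < 1 / Suc m \<longrightarrow>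
      norm (real_of_rat q *\<^sub>R (f (z * cis (of_rat p)) - f (z * cis 0)) - real_of_rat p *\<^sub>R (f (z * cis (of_rat q)) - f (z * cis 0)))
        \<le> \<bar>real_of_rat p\<bar> * \<bar>real_of_rat q\<bar> / Suc n} = {z \<in> space circle_haar. circle_differentiable f z}"
    using circle_differentiable_iff_Cauchy[OF continuous_on_circle_rotate[OF f]] by (intro Collect_cong conj_cong) auto
  finally show ?thesis .
qed

text \<open>On the measurable set of differentiability the derivative agrees with a measurable
  function, and off it with one fixed constant.\<close>

lemma borel_measurable_zderiv:
  fixes f g :: "complex \<Rightarrow> complex"
  assumes f: "continuous_on (sphere 0 1) f" and g: "g \<in> borel_measurable circle_haar"
    and eq: "\<And>z. z \<in> sphere 0 1 \<Longrightarrow> circle_differentiable f z \<Longrightarrow> zderiv f z = g z"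
  shows "zderiv f \<in> borel_measurable circle_haar"
proof -
  \<comment> \<open>Without a derivative the choice in \<open>vector_derivative\<close> is from an
    empty predicate, hence the same at every such point.\<close>
  define c where "c = - \<i> * (SOME d :: complex. False)"
  have nd: "zderiv f z = c" if "\<not> circle_differentiable f z" for z
  proof -
    have "\<not> ((\<lambda>t. f (z * cis t)) has_vector_derivative d) (at 0)" for d
      using that unfolding circle_differentiable_def by (auto dest: differentiableI_vector)
    then show ?thesis by (simp add: zderiv_def vector_derivative_def c_def)
  qed
  have [measurable]: "Measurable.pred circle_haar (circle_differentiable f)"
    using sets_circle_differentiable[OF f] by (simp add: pred_def)
  note g [measurable]
  have "(\<lambda>z. if circle_differentiable f z then g z else c) \<in> borel_measurable circle_haar"
    by measurable
  then show ?thesis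
    by (rule measurable_cong[THEN iffD1, rotated]) (auto simp: eq nd)
qed

text \<open>A continuous nonnegative function with integral 0 vanishes. This upgrades the symmetry
  of the weight from almost everywhere to everywhere, so that it can be differentiated.\<close>

lemma continuous_circle_AE_eq:
  fixes f g :: "complex \<Rightarrow> complex"
  assumes "continuous_on (sphere 0 1) f" "continuous_on (sphere 0 1) g"
    and "AE z in circle_haar. f z = g z" and z: "z \<in> sphere 0 1"
  shows "f z = g z"
proof -
  define h where "h t = norm (f (cis t) - g (cis t))" for t
  have cont: "continuous_on {0..2 * pi} h"
    unfolding h_def by (intro continuous_intros continuous_on_circle_cis assms(1,2))
  have "(h has_integral 0) {0..2 * pi}"
    by (rule has_integral_negligible[OF AE_circle_haar_negligible[OF assms(3)]]) (auto simp: h_def)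
  then have "\<forall>t\<in>{0..2 * pi}. h t = 0"
    using integral_eq_0_iff[OF cont] by (auto simp: integral_unique h_def)
  moreover obtain t where "0 \<le> t" "t < 2 * pi" "z = cis t" using z by (rule sphere_cisE)
  ultimately show ?thesis by (auto simp: h_def)
qed

section \<open>The reflected weight\<close>

text \<open>This form turns the transform into an index shift. The form cnj (w (cnj z)), which
  commutes with derivatives, is equal to it only almost everywhere in general.\<close>

definition reflected_weight :: "nat \<Rightarrow> (complex \<Rightarrow> complex) \<Rightarrow> complex \<Rightarrow> complex" where
  "reflected_weight N w z = z powi (1 - int N) * w (inverse z)"

lemma inverse_eq_cnj_sphere: "z \<in> sphere (0::complex) 1 \<Longrightarrow> inverse z = cnj z"
  by (metis complex_norm_square inverse_unique mem_sphere_0 mult_1 of_real_1 one_power2)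

lemma AE_reflected_weight:
  assumes "w \<in> L1 N" "N \<ge> 1"
  shows "AE z in circle_haar. reflected_weight N w z = cnj (w (cnj z))"
proof -
  have "AE z in circle_haar. cnj (w z) = z ^ (N - 1) * w z" using assms(1) by (simp add: L1_def)
  from AE_circle_haar_cnj[OF this] show ?thesis using AE_space
  proof eventually_elim
    case (elim z)
    then have z: "inverse z = cnj z" by (intro inverse_eq_cnj_sphere) simp
    have "z powi (1 - int N) = inverse z ^ (N - 1)"
      using assms(2) by (auto simp: power_int_def nat_diff_distrib)
    then show ?case using elim(1) z by (simp add: reflected_weight_def)
  qed
qed

text \<open>For N >= 2, continuity makes both forms of the reflected weight agree on the whole
  circle, so the derivatives up to order \<open>N - 2\<close> agree everywhere. At order
  \<open>N - 1\<close> they agree at points of differentiability. For N = 1 only the almost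
  everywhere identity of the weights is needed.\<close>

lemma L1_diff_reflected_weight:
  assumes w: "w \<in> L1_diff N" and N1: "N \<ge> 1"
  shows "reflected_weight N w \<in> L1_diff N"
    and "\<And>j. j \<le> N - 1 \<Longrightarrow>
      AE z in circle_haar. (zderiv ^^ j) (reflected_weight N w) z = cnj ((zderiv ^^ j) w (cnj z))"
proof -
  define v where "v = reflected_weight N w"
  have wL1: "w \<in> L1 N" and wint: "integrable circle_haar w" using w by (simp_all add: L1_diff_def L1_def)
  have vAE: "AE z in circle_haar. v z = cnj (w (cnj z))"
    unfolding v_def by (rule AE_reflected_weight[OF wL1 N1])
  have vint: "integrable circle_haar v"
  proof -
    have "integrable circle_haar (\<lambda>z. z powi (1 - int N) * w (cnj z))"
      by (intro integrable_circle_bounded_mult integrable_circle_haar_cnj wint continuous_on_circle_powi)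
    then show ?thesis
      by (rule Bochner_Integration.integrable_cong[THEN iffD1, rotated 2])
        (auto simp: v_def reflected_weight_def inverse_eq_cnj_sphere)
  qed
  have vL1: "v \<in> L1 N"
    unfolding L1_def
  proof (intro CollectI conjI vint)
    show "AE z in circle_haar. cnj (v z) = z ^ (N - 1) * v z"
      using vAE AE_space
    proof eventually_elim
      case (elim z)
      then have z: "z \<noteq> 0" "inverse z = cnj z" by (auto intro: inverse_eq_cnj_sphere)
      have "z ^ (N - 1) * v z = (z ^ (N - 1) * z powi (1 - int N)) * w (cnj z)"
        by (simp add: v_def reflected_weight_def z)
      also have "z ^ (N - 1) * z powi (1 - int N) = 1"
        using N1 z(1) by (auto simp: power_int_def nat_diff_distrib power_inverse)
      finally show ?case using elim(1) by simp
    qed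
  qed
  have cont0: "continuous_on (sphere 0 1) (\<lambda>z. cnj (f (cnj z)))"
    if "continuous_on (sphere 0 1) f" for f :: "complex \<Rightarrow> complex"
    by (intro continuous_on_cnj continuous_on_compose2[OF that]) (auto intro!: continuous_intros)
  have sph: "(zderiv ^^ j) v z = cnj ((zderiv ^^ j) w (cnj z))"
    if "N \<ge> 2" "j \<le> N - 2" "z \<in> sphere 0 1" for j z
    using that(2,3)
  proof (induction j arbitrary: z)
    case 0
    have wc: "continuous_on (sphere 0 1) w" using L1_diff_zderiv(1)[OF w, of 0] \<open>N \<ge> 2\<close> by simp
    have "continuous_on (sphere 0 1) (\<lambda>z. z powi (1 - int N) * w (cnj z))"
      by (intro continuous_on_mult continuous_on_circle_powi continuous_on_compose2[OF wc])
        (auto intro!: continuous_intros)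
    then have "continuous_on (sphere 0 1) v"
      by (rule continuous_on_cong[THEN iffD1, rotated 2])
        (auto simp: v_def reflected_weight_def inverse_eq_cnj_sphere)
    from continuous_circle_AE_eq[OF this cont0[OF wc] vAE 0(2)] show ?case by simp
  next
    case (Suc j)
    have "(zderiv ^^ Suc j) v z = zderiv (\<lambda>z. cnj ((zderiv ^^ j) w (cnj z))) z"
      using zderiv_cong_sphere(1)[of "(zderiv ^^ j) v"] Suc by simp
    \<comment> \<open>Here j < N - 2, where differentiability holds at every point of the
      circle.\<close>
    also have "\<dots> = cnj (zderiv ((zderiv ^^ j) w) (cnj z))"
      using w Suc(2,3) \<open>N \<ge> 2\<close> by (intro zderiv_cnj_cnj) (simp add: L1_diff_def)
    finally show ?case by simp
  qed
  have dif: "circle_differentiable ((zderiv ^^ j) v) z \<longleftrightarrow> circle_differentiable ((zderiv ^^ j) w) (cnj z)"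
    if "N \<ge> 2" "j \<le> N - 2" "z \<in> sphere 0 1" for j z
    using zderiv_cong_sphere(2)[OF sph[OF that(1,2)] that(3)] by (simp add: circle_differentiable_cnj_cnj)
  have zd: "zderiv ((zderiv ^^ j) v) z = cnj (zderiv ((zderiv ^^ j) w) (cnj z))"
    if "N \<ge> 2" "j \<le> N - 2" "z \<in> sphere 0 1" "circle_differentiable ((zderiv ^^ j) v) z" for j z
    using zderiv_cong_sphere(1)[OF sph[OF that(1,2)] that(3)] zderiv_cnj_cnj(1)[of "(zderiv ^^ j) w" z]
      dif[OF that(1-3)] that(4) by simp
  have cont: "continuous_on (sphere 0 1) ((zderiv ^^ j) v)" if "N \<ge> 2" "j \<le> N - 2" for j
  proof -
    have "continuous_on (sphere 0 1) (\<lambda>z. cnj ((zderiv ^^ j) w (cnj z)))"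
      using L1_diff_zderiv(1)[OF w, of j] that by (intro cont0) auto
    then show ?thesis
      by (rule continuous_on_cong[THEN iffD1, rotated 2]) (auto simp: sph[OF that])
  qed
  have difAE: "AE z in circle_haar. circle_differentiable ((zderiv ^^ (N - 2)) v) z" if N: "N \<ge> 2"
  proof -
    have "AE z in circle_haar. circle_differentiable ((zderiv ^^ (N - 2)) w) z"
      using N by (intro L1_diff_zderiv(3)[OF w]) auto
    from AE_circle_haar_cnj[OF this] show ?thesis using AE_space
      by eventually_elim (use N in \<open>auto simp: dif\<close>)
  qed
  have AEeq: "AE z in circle_haar. (zderiv ^^ j) v z = cnj ((zderiv ^^ j) w (cnj z))" if j: "j \<le> N - 1" for j
  proof (cases "N = 1")
    case True
    then show ?thesis using j vAE by simp
  next
    case False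
    then have N: "N \<ge> 2" using N1 by simp
    show ?thesis
    proof (cases "j \<le> N - 2")
      case True
      show ?thesis using AE_space by eventually_elim (use sph[OF N True] in auto)
    next
      case False
      then have j: "j = Suc (N - 2)" using j N by simp
      show ?thesis using difAE[OF N] AE_space unfolding j
        by eventually_elim (use zd[OF N] in auto)
    qed
  qed
  have int: "integrable circle_haar ((zderiv ^^ j) v)" if j: "j \<le> N - 1" for j
  proof -
    have i: "integrable circle_haar (\<lambda>z. cnj ((zderiv ^^ j) w (cnj z)))"
      using L1_diff_integrable[OF w j] by (intro integrable_cnj integrable_circle_haar_cnj)
    \<comment> \<open>Agreement almost everywhere with an integrable function does not give
      measurability, since the sigma-algebra is not completed.\<close>
    have "(zderiv ^^ j) v \<in> borel_measurable circle_haar"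
    proof (cases "j = 0")
      case True
      then show ?thesis using vint by auto
    next
      case False
      then have N: "N \<ge> 2" using j by simp
      from False obtain m where m: "j = Suc m" using not0_implies_Suc by blast
      then have mN: "m \<le> N - 2" using j by simp
      have "zderiv ((zderiv ^^ m) v) \<in> borel_measurable circle_haar"
      proof (rule borel_measurable_zderiv[OF cont[OF N mN]])
        show "(\<lambda>z. cnj ((zderiv ^^ j) w (cnj z))) \<in> borel_measurable circle_haar"
          using i by (rule borel_measurable_integrable)
        show "zderiv ((zderiv ^^ m) v) z = cnj ((zderiv ^^ j) w (cnj z))"
          if "z \<in> sphere 0 1" "circle_differentiable ((zderiv ^^ m) v) z" for z
          using zd[OF N mN that] m by simp
      qed
      then show ?thesis using m by simp
    qed
    then show ?thesis
      using i AEeq[OF j] by (subst integrable_cong_AE[OF _ borel_measurable_integrable[OF i]]) auto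
  qed
  have ac: "absolutely_continuous_on {0..2 * pi} (\<lambda>t. (zderiv ^^ (N - 2)) v (cis t))" if N: "N \<ge> 2"
  proof -
    define f where "f t = (zderiv ^^ (N - 2)) w (cis t)" for t
    have "absolutely_continuous_on {0..2 * pi} f"
      unfolding f_def using N by (intro L1_diff_zderiv(2)[OF w]) auto
    then have "absolutely_continuous_on {0..2 * pi} (\<lambda>t. f (2 * pi - t))"
      by (rule absolutely_continuous_on_reflect)
    then have "absolutely_continuous_on {0..2 * pi} (\<lambda>t. cnj (f (2 * pi - t)))"
      by (rule absolutely_continuous_on_dominated[where C=1 and B=0])
        (simp_all add: complex_cnj_diff[symmetric] del: complex_cnj_diff)
    moreover have "cnj (f (2 * pi - t)) = (zderiv ^^ (N - 2)) v (cis t)" for t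
    proof -
      have "cis (2 * pi - t) = cnj (cis t)" by (simp add: complex_eq_iff cos_diff sin_diff)
      then show ?thesis using sph[OF N order_refl, of "cis t"] by (simp add: f_def)
    qed
    ultimately show ?thesis by simp
  qed
  show "reflected_weight N w \<in> L1_diff N"
    unfolding v_def[symmetric] L1_diff_def
  proof (intro CollectI conjI vL1 allI impI ballI)
    show "circle_differentiable ((zderiv ^^ j) v) z" if "2 \<le> N" "j < N - 2" "z \<in> sphere 0 1" for j z
      using dif[OF that(1) _ that(3), of j] that w by (simp add: L1_diff_def)
  qed (simp_all add: int cont ac difAE)
  show "AE z in circle_haar. (zderiv ^^ j) (reflected_weight N w) z = cnj ((zderiv ^^ j) w (cnj z))"
    if "j \<le> N - 1" for j
    using AEeq[OF that] unfolding v_def .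
qed

text \<open>After the substitution z -> cnj z, which is 1/z on the circle, the exponent s + 1 - N
  changes its sign.\<close>

lemma circle_transform_reflected_weight:
  assumes "w \<in> borel_measurable circle_haar"
  shows "circle_transform (reflected_weight N w) s = circle_transform w (int N - s - 1)"
proof -
  have m: "(\<lambda>z. z powi (int N - s - 1) * w z) \<in> borel_measurable circle_haar"
    using assms borel_measurable_circle_continuous[OF continuous_on_circle_powi] by measurable
  have "circle_transform (reflected_weight N w) s = (LINT z|circle_haar. cnj z powi (int N - s - 1) * w (cnj z))"
    unfolding circle_transform_def reflected_weight_def
  proof (rule Bochner_Integration.integral_cong[OF refl])
    fix z assume "z \<in> space circle_haar"
    then have z: "z \<noteq> 0" "inverse z = cnj z" by (auto intro: inverse_eq_cnj_sphere)
    have "z powi s * z powi (1 - int N) = inverse z powi (int N - s - 1)"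
    proof -
      have "inverse z powi (int N - s - 1) = z powi (- (int N - s - 1))"
        by (simp only: power_int_inverse power_int_minus)
      also have "- (int N - s - 1) = s + (1 - int N)" by simp
      also have "z powi (s + (1 - int N)) = z powi s * z powi (1 - int N)"
        by (rule power_int_add) (simp add: z)
      finally show ?thesis by simp
    qed
    then show "z powi s * (z powi (1 - int N) * w (inverse z)) = cnj z powi (int N - s - 1) * w (cnj z)"
      using z(2) by (simp add: mult.assoc[symmetric])
  qed
  also have "\<dots> = circle_transform w (int N - s - 1)"
    unfolding circle_transform_def using integral_circle_haar_cnj[OF m] by simp
  finally show ?thesis .
qed

section \<open>The torus\<close>

lemma product_prob_space_circle: "product_prob_space (\<lambda>_. circle_haar)"
  by (intro product_prob_spaceI prob_space_circle_haar)

lemma product_sigma_finite_circle: "product_sigma_finite (\<lambda>_. circle_haar)"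
  by (rule product_prob_space.axioms(1)[OF product_prob_space_circle])

lemma space_torus_haar:
  "space (torus_haar :: ('n::finite \<Rightarrow> complex) measure) = {z. \<forall>a. norm (z a) = 1}"
  by (auto simp: space_PiM)

lemma AE_torus_component:
  assumes "AE z in circle_haar. P z"
  shows "AE z in (torus_haar :: ('n::finite \<Rightarrow> complex) measure). \<forall>a. P (z a)"
  unfolding AE_all_countable
  by (intro allI AE_PiM_component prob_space_circle_haar assms) simp

lemma measurable_torus_component [measurable]:
  "(\<lambda>z. z a) \<in> borel_measurable (torus_haar :: ('n::finite \<Rightarrow> complex) measure)"
proof -
  have "(\<lambda>z. z) \<in> borel_measurable circle_haar"
    by (intro borel_measurable_circle_continuous continuous_intros)
  then show ?thesis by measurable
qed

lemma borel_measurable_det: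
  assumes "\<And>a b. (\<lambda>x. A x a b :: complex) \<in> borel_measurable M"
  shows "(\<lambda>x. det (\<chi> a b. A x a b)) \<in> borel_measurable M"
  unfolding det_def using assms
  by (auto intro!: borel_measurable_sum borel_measurable_times borel_measurable_prod)

lemma borel_measurable_vandermonde [measurable]:
  "vandermonde \<in> borel_measurable (torus_haar :: ('n::{finite,linorder} \<Rightarrow> complex) measure)"
  unfolding vandermonde_eq_det[abs_def] by (intro borel_measurable_det) measurable

lemma measurable_torus_cnj [measurable]:
  "(\<lambda>z a. cnj (z a)) \<in> measurable (torus_haar :: ('n::finite \<Rightarrow> complex) measure) torus_haar"
  by (rule measurable_PiM_single') (auto simp: space_PiM)

lemma distr_torus_haar_cnj:
  "distr torus_haar torus_haar (\<lambda>z a. cnj (z a)) = (torus_haar :: ('n::finite \<Rightarrow> complex) measure)"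
proof -
  have "distr (PiM (UNIV::'n set) (\<lambda>_. circle_haar)) (PiM UNIV (\<lambda>_. circle_haar)) (compose UNIV cnj) =
      PiM UNIV (\<lambda>_. distr circle_haar circle_haar cnj)"
    by (rule distr_PiM_finite_prob_space) (auto intro: product_prob_space_circle)
  moreover have "compose (UNIV::'n set) cnj = (\<lambda>z (a::'n). cnj (z a))" by (intro ext) (simp add: compose_def)
  ultimately show ?thesis by (simp add: distr_circle_haar_cnj)
qed

lemma AE_torus_cnj:
  assumes "AE z in (torus_haar :: ('n::finite \<Rightarrow> complex) measure). P z"
  shows "AE z in torus_haar. P (\<lambda>a. cnj (z a))"
proof (rule AE_distrD[OF measurable_torus_cnj])
  show "AE z in distr torus_haar torus_haar (\<lambda>z a. cnj (z a)). P z"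
    using assms by (simp only: distr_torus_haar_cnj)
qed

text \<open>Both determinants are expanded over permutations, and the integral of each product
  factorises over the coordinates.\<close>

lemma andreief_identity:
  fixes f g :: "'n::finite \<Rightarrow> complex \<Rightarrow> complex"
  assumes int: "\<And>i j. integrable circle_haar (\<lambda>z. f i z * g j z)"
  shows "(LINT z|torus_haar. det (\<chi> a b::'n. f b (z (a::'n))) * det (\<chi> a b::'n. g b (z (a::'n)))) =
    fact CARD('n) * det (\<chi> i j::'n. LINT z|circle_haar. f (i::'n) z * g j z)"
proof -
  interpret product_sigma_finite "\<lambda>_::'n. circle_haar" by (rule product_sigma_finite_circle)
  define P where "P = {\<sigma>::'n \<Rightarrow> 'n. \<sigma> permutes UNIV}"
  define c where "c = (\<chi> i j::'n. LINT z|circle_haar. f (i::'n) z * g j z)"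
  have expand: "det (\<chi> a b::'n. f b (z (a::'n))) * det (\<chi> a b::'n. g b (z (a::'n))) =
      (\<Sum>\<sigma>\<in>P. \<Sum>\<tau>\<in>P. (of_int (sign \<sigma>) * of_int (sign \<tau>)) * (\<Prod>a\<in>UNIV. f (\<sigma> a) (z a) * g (\<tau> a) (z a)))"
    for z
    by (simp add: det_def P_def sum_product prod.distrib algebra_simps)
  have intp: "integrable torus_haar (\<lambda>z. \<Prod>a\<in>UNIV. f (\<sigma> a) (z a) * g (\<tau> a) (z a))" for \<sigma> \<tau> :: "'n \<Rightarrow> 'n"
    by (rule product_integrable_prod) (auto intro: int)
  have "(LINT z|torus_haar. det (\<chi> a b::'n. f b (z (a::'n))) * det (\<chi> a b::'n. g b (z (a::'n)))) =
      (\<Sum>\<sigma>\<in>P. \<Sum>\<tau>\<in>P. (of_int (sign \<sigma>) * of_int (sign \<tau>)) *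
        (LINT z|torus_haar. (\<Prod>a\<in>UNIV. f (\<sigma> a) (z a) * g (\<tau> a) (z a))))"
    unfolding expand using intp by (simp add: Bochner_Integration.integral_sum)
  also have "\<dots> = (\<Sum>\<sigma>\<in>P. \<Sum>\<tau>\<in>P. (of_int (sign \<sigma>) * of_int (sign \<tau>)) * (\<Prod>a\<in>UNIV. c $ \<sigma> a $ \<tau> a))"
    by (intro sum.cong refl arg_cong2[where f="(*)"], subst product_integral_prod) (auto simp: c_def int)
  \<comment> \<open>For fixed \<open>\<sigma>\<close> the inner sum is the determinant of
    \<open>c\<close> with permuted rows; its sign cancels the outer one, leaving N! equal
    terms.\<close>
  also have "\<dots> = (\<Sum>\<sigma>\<in>P. of_int (sign \<sigma>) * det (\<chi> i. c $ \<sigma> i))"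
    by (simp add: det_def P_def sum_distrib_left mult.assoc)
  also have "\<dots> = (\<Sum>\<sigma>\<in>P. det c)"
  proof (rule sum.cong[OF refl])
    fix \<sigma> assume "\<sigma> \<in> P"
    then have "det (\<chi> i. c $ \<sigma> i) = of_int (sign \<sigma>) * det c"
      by (simp add: P_def det_permute_rows)
    moreover have "of_int (sign \<sigma>) * of_int (sign \<sigma>) = (1::complex)"
      by (metis of_int_1 of_int_mult sign_idempotent)
    ultimately show "of_int (sign \<sigma>) * det (\<chi> i. c $ \<sigma> i) = det c"
      by (simp add: mult.assoc[symmetric])
  qed
  also have "\<dots> = fact CARD('n) * det c"
    by (simp add: P_def card_permutations[of UNIV "CARD('n)"])
  finally show ?thesis by (simp add: c_def)
qed

section \<open>Continuous extension of the spherical functions\<close>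

text \<open>The \<open>Lim\<close> in \<open>spherical_function\<close> is only met on a null set of matrices, but the Bochner
  integral of a non-measurable integrand is 0, so its value there has to be controlled too.\<close>

definition spherical_extension :: "('n::{finite,linorder} \<Rightarrow> int) \<Rightarrow> ('n \<Rightarrow> complex) \<Rightarrow> complex" where
  "spherical_extension s z =
     (\<Prod>j<CARD('n). fact j) / vandermonde (\<lambda>a. of_int (s a)) *
     ((\<Prod>a\<in>UNIV. z a powi Min (range s)) *
      det (\<chi> c b. newton_coeff (nodes z) (nat (s b - Min (range s))) (card {..<c})))"

text \<open>Pulling the smallest exponent out of every row leaves nonnegative exponents, to which
  \<open>alternant_eq\<close> applies. The product form stays valid when entries of z
  coincide.\<close>

lemma vandermonde_mult_spherical_extension:
  fixes z :: "'n::{finite,linorder} \<Rightarrow> complex"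
  assumes "\<And>a. z a \<noteq> 0"
  shows "vandermonde z * spherical_extension s z =
    (\<Prod>j<CARD('n). fact j) / vandermonde (\<lambda>a. of_int (s a)) * det (\<chi> a b. z a powi s b)"
proof -
  define m where "m = Min (range s)"
  have "z a powi s b = z a powi m * z a ^ nat (s b - m)" for a b
  proof -
    have "m \<le> s b" by (simp add: m_def)
    then have "z a powi s b = z a powi (m + int (nat (s b - m)))" by simp
    also have "\<dots> = z a powi m * z a ^ nat (s b - m)"
      by (subst power_int_add) (simp_all add: assms del: int_nat_eq)
    finally show ?thesis .
  qed
  then have "(\<chi> a b. z a powi s b) = (\<chi> a. z a powi m *s (\<chi> a b. z a ^ nat (s b - m)) $ a)"
    by (simp add: vec_eq_iff)
  then have "det (\<chi> a b. z a powi s b) = (\<Prod>a\<in>UNIV. z a powi m) * det (\<chi> a b. z a ^ nat (s b - m))"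
    by (simp only: det_rows_mul) (simp add: vec_lambda_eta)
  then show ?thesis
    unfolding alternant_eq by (simp add: spherical_extension_def m_def algebra_simps)
qed

lemma spherical_ratio_eq_extension:
  assumes "inj z" "\<And>a. z a \<noteq> 0"
  shows "spherical_ratio s z = spherical_extension s z"
proof -
  have v: "vandermonde z \<noteq> 0" using assms(1) by (simp add: vandermonde_eq_0_iff)
  have "vandermonde z * spherical_ratio s z = vandermonde z * spherical_extension s z"
    unfolding vandermonde_mult_spherical_extension[OF assms(2)] spherical_ratio_def using v by simp
  then show ?thesis using v by simp
qed

lemma continuous_on_spherical_extension:
  "continuous_on {z. \<forall>a. norm (z a) = 1} (spherical_extension s)"
proof -
  have coord: "continuous_on S (\<lambda>z::'a \<Rightarrow> complex. z a)" for S a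
    by (rule continuous_on_subset[OF continuous_on_product_coordinates]) simp
  \<comment> \<open>The recursion never changes the nodes, so the node argument of the induction
    rule is filled with a dummy.\<close>
  have newton: "continuous_on S (\<lambda>z::'a \<Rightarrow> complex. newton_coeff (nodes z) k c)" for S k c
    by (induction "\<lambda>_::nat. 0::complex" k c rule: newton_coeff.induct)
      (auto simp: nodes_def intro!: continuous_intros coord)
  have pw: "continuous_on {z. \<forall>a. norm (z a) = 1} (\<lambda>z::'a \<Rightarrow> complex. z a powi m)" for a m
  proof (rule continuous_on_power_int[OF coord], intro disjI2 ballI)
    fix z :: "'a \<Rightarrow> complex" assume "z \<in> {z. \<forall>a. norm (z a) = 1}"
    then have "norm (z a) = 1" by simp
    then show "z a \<noteq> 0" by auto
  qed
  show ?thesis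
    unfolding spherical_extension_def det_def
    by (intro continuous_intros continuous_on_prod pw) (auto intro!: continuous_intros newton)
qed

lemma borel_measurable_spherical_extension:
  "spherical_extension s \<in> borel_measurable torus_haar"
proof -
  have newton: "(\<lambda>z. newton_coeff (nodes z) k c) \<in> borel_measurable torus_haar" for k c
    by (induction "\<lambda>_::nat. 0::complex" k c rule: newton_coeff.induct)
      (auto simp: nodes_def intro!: borel_measurable_times borel_measurable_add measurable_torus_component)
  have pw: "(\<lambda>z. z a powi m) \<in> borel_measurable torus_haar" for a m
    unfolding power_int_def by measurable
  show ?thesis
    unfolding spherical_extension_def[abs_def]
    by (intro borel_measurable_times borel_measurable_const borel_measurable_prod pw borel_measurable_det newton)
qed

section \<open>Approximation by distinct eigenvalues\<close>

text \<open>A path in the torus starting at z on which the entries rotate with pairwise different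
  speeds, so that coinciding ones separate at once.\<close>

definition spread :: "('n::{finite,linorder} \<Rightarrow> complex) \<Rightarrow> real \<Rightarrow> 'n \<Rightarrow> complex" where
  "spread z t a = z a * cis (t * real (card {..<a}))"

lemma spread_tendsto: "(spread z \<longlongrightarrow> z) (at_right 0)"
proof -
  have "continuous_on UNIV (spread z)"
    unfolding spread_def[abs_def]
    by (intro continuous_on_coordinatewise_then_product continuous_intros)
  then have "isCont (spread z) 0" by (simp add: continuous_on_eq_continuous_at)
  then have "(spread z \<longlongrightarrow> spread z 0) (at_right 0)"
    by (simp add: isCont_def filterlim_at_split)
  then show ?thesis by (simp add: spread_def[abs_def])
qed

lemma norm_spread: "norm (spread z t a) = norm (z a)"
  by (simp add: spread_def norm_mult)

lemma eventually_inj_spread: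
  assumes z: "\<And>a. norm (z a) = 1"
  shows "\<forall>\<^sub>F t in at_right 0. inj (spread z t)"
proof -
  have "\<forall>\<^sub>F t in at_right 0. spread z t a \<noteq> spread z t b" if ab: "a < b" for a b
  proof (cases "z a = z b")
    case True
    \<comment> \<open>The difference of speeds. While t d stays below pi, the relative rotation has
      positive sine and cannot be trivial.\<close>
    define d where "d = real (card {..<b}) - real (card {..<a})"
    have d: "d > 0" using card_lessThan_strict_mono[OF ab] by (simp add: d_def)
    have "\<forall>\<^sub>F t in at_right 0. 0 < t \<and> t < pi / d"
      using d by (auto simp: eventually_at_right_field intro!: exI[of _ "pi / d"])
    then show ?thesis
    proof eventually_elim
      case (elim t)
      then have "0 < t * d" "t * d < pi" using d by (auto simp: pos_less_divide_eq)
      then have "sin (t * d) > 0" by (rule sin_gt_zero)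
      then have ne: "cis (t * d) \<noteq> 1" by (auto simp: complex_eq_iff)
      have "spread z t b = spread z t a * cis (t * d)"
        by (simp add: spread_def True d_def cis_mult mult.assoc algebra_simps)
      moreover have "spread z t a \<noteq> 0" using norm_spread[of z t a] z[of a] by auto
      ultimately show ?case using ne by auto
    qed
  next
    case False
    have "((\<lambda>t. spread z t a - spread z t b) \<longlongrightarrow> spread z 0 a - spread z 0 b) (at_right 0)"
      unfolding spread_def by (intro tendsto_intros)
    moreover have "spread z 0 a - spread z 0 b \<noteq> 0" using False by (simp add: spread_def)
    ultimately have "\<forall>\<^sub>F t in at_right 0. spread z t a - spread z t b \<noteq> 0"
      by (rule tendsto_imp_eventually_ne)
    then show ?thesis by eventually_elim simp
  qed
  then have "\<forall>\<^sub>F t in at_right 0. \<forall>ab\<in>{(a, b). a < b}. spread z t (fst ab) \<noteq> spread z t (snd ab)"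
    by (subst eventually_ball_finite_distrib) auto
  then show ?thesis
  proof eventually_elim
    case (elim t)
    then have "spread z t a \<noteq> spread z t b" if "a < b" for a b using that by fastforce
    then show ?case by (intro injI) (metis linorder_neqE)
  qed
qed

text \<open>On distinct tuples the ratio is the continuous extension, so only the existence of
  approximating distinct tuples is at stake.\<close>

lemma spherical_ratio_Lim:
  fixes z :: "'n::{finite,linorder} \<Rightarrow> complex"
  assumes z: "\<And>a. norm (z a) = 1" and "\<not> inj z"
  shows "Lim (at z within {y. inj y \<and> (\<forall>a. y a \<in> sphere 0 1)}) (spherical_ratio s) = spherical_extension s z"
proof (rule tendsto_Lim)
  let ?T = "{y::'n \<Rightarrow> complex. inj y \<and> (\<forall>a. y a \<in> sphere 0 1)}"
  \<comment> \<open>\<open>Lim\<close> is determined only for a nontrivial filter; the path reaches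
    z through distinct tuples, and these differ from z because z is not injective.\<close>
  have "filterlim (spread z) (at z within ?T) (at_right 0)"
    unfolding filterlim_at
  proof
    show "\<forall>\<^sub>F t in at_right 0. spread z t \<in> ?T \<and> spread z t \<noteq> z"
      using eventually_inj_spread[OF z] by eventually_elim (use assms in \<open>auto simp: norm_spread\<close>)
  qed (rule spread_tendsto)
  then show "at z within ?T \<noteq> bot"
    by (metis filterlim_def filtermap_bot_iff le_bot trivial_limit_at_right_real)
  have "(spherical_extension s \<longlongrightarrow> spherical_extension s z) (at z within {z. \<forall>a. norm (z a) = 1})"
    using continuous_on_spherical_extension[of s] z by (simp add: continuous_on_def)
  then have "(spherical_extension s \<longlongrightarrow> spherical_extension s z) (at z within ?T)"
    by (rule tendsto_within_subset) auto
  moreover have "\<forall>\<^sub>F y in at z within ?T. spherical_extension s y = spherical_ratio s y"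
    unfolding eventually_at_filter
  proof (intro always_eventually allI impI)
    fix y assume y: "y \<in> ?T"
    then have "norm (y a) = 1" for a by simp
    then have "y a \<noteq> 0" for a by (metis norm_eq_zero zero_neq_one)
    with y show "spherical_extension s y = spherical_ratio s y"
      by (simp add: spherical_ratio_eq_extension)
  qed
  ultimately show "(spherical_ratio s \<longlongrightarrow> spherical_extension s z) (at z within ?T)"
    by (rule Lim_transform_eventually)
qed

lemma spherical_function_eq_extension:
  assumes "A \<in> unitary_group"
  shows "spherical_function A s = spherical_extension s (eigenvalues A)"
proof -
  have n: "norm (eigenvalues A a) = 1" for a by (rule norm_eigenvalue_unitary[OF assms])
  then have "eigenvalues A a \<noteq> 0" for a by (metis norm_zero zero_neq_one)
  then show ?thesis
    unfolding spherical_function_def Let_def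
    using spherical_ratio_eq_extension[of "eigenvalues A" s] spherical_ratio_Lim[of "eigenvalues A" s] n
    by simp
qed

text \<open>Divided differences depend on the order of the nodes, so symmetry is not visible in the
  formula. For distinct entries alternant and Vandermonde determinant change by the same sign; the
  rest follows by continuity along \<open>spread\<close>.\<close>

lemma spherical_extension_permute:
  fixes z :: "'n::{finite,linorder} \<Rightarrow> complex"
  assumes p: "\<pi> permutes UNIV" and z: "\<And>a. norm (z a) = 1"
  shows "spherical_extension s (z \<circ> \<pi>) = spherical_extension s z"
proof -
  have inj_case: "spherical_extension s (y \<circ> \<pi>) = spherical_extension s y"
    if y: "inj y" "\<And>a. norm (y a) = 1" for y :: "'n \<Rightarrow> complex"
  proof -
    have "y a \<noteq> 0" for a using y(2)[of a] by auto
    moreover have "inj (y \<circ> \<pi>)" using y(1) permutes_inj[OF p] by (rule inj_compose)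
    moreover have "spherical_ratio s (y \<circ> \<pi>) = spherical_ratio s y"
    proof -
      have "det (\<chi> a b. (y \<circ> \<pi>) a powi s b) = of_int (sign \<pi>) * det (\<chi> a b. y a powi s b)"
        using det_permute_rows[OF p, of "\<chi> a b. y a powi s b"] by simp
      moreover have "of_int (sign \<pi>) \<noteq> (0::complex)" by (simp add: sign_def)
      ultimately show ?thesis unfolding spherical_ratio_def vandermonde_permute[OF p] by simp
    qed
    ultimately show ?thesis
      using spherical_ratio_eq_extension[of y s] spherical_ratio_eq_extension[of "y \<circ> \<pi>" s] y(1) by simp
  qed
  have cont: "((\<lambda>t. spherical_extension s (h t)) \<longlongrightarrow> spherical_extension s y) (at_right 0)"
    if "(h \<longlongrightarrow> y) (at_right 0)" "\<And>t a. norm (h t a) = 1" "\<And>a. norm (y a) = 1"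
    for h :: "real \<Rightarrow> 'n \<Rightarrow> complex" and y
    by (rule continuous_on_tendsto_compose[OF continuous_on_spherical_extension that(1)]) (use that in auto)
  have lim: "((\<lambda>t. spread z t \<circ> \<pi>) \<longlongrightarrow> z \<circ> \<pi>) (at_right 0)"
  proof -
    have "continuous_on UNIV (\<lambda>y::'n \<Rightarrow> complex. y \<circ> \<pi>)"
      unfolding o_def by (intro continuous_on_coordinatewise_then_product continuous_on_product_coordinates)
    then have "isCont (\<lambda>y::'n \<Rightarrow> complex. y \<circ> \<pi>) z" by (simp add: continuous_on_eq_continuous_at)
    then show ?thesis using spread_tendsto by (rule isCont_tendsto_compose)
  qed
  have "((\<lambda>t. spherical_extension s (spread z t \<circ> \<pi>)) \<longlongrightarrow> spherical_extension s (z \<circ> \<pi>)) (at_right 0)"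
    by (rule cont[OF lim]) (auto simp: norm_spread z)
  moreover have "\<forall>\<^sub>F t in at_right 0. spherical_extension s (spread z t \<circ> \<pi>) = spherical_extension s (spread z t)"
    using eventually_inj_spread[OF z] by eventually_elim (auto intro!: inj_case simp: norm_spread z)
  ultimately have "((\<lambda>t. spherical_extension s (spread z t)) \<longlongrightarrow> spherical_extension s (z \<circ> \<pi>)) (at_right 0)"
    by (rule Lim_transform_eventually)
  moreover have "((\<lambda>t. spherical_extension s (spread z t)) \<longlongrightarrow> spherical_extension s z) (at_right 0)"
    by (rule cont[OF spread_tendsto]) (auto simp: norm_spread z)
  ultimately show ?thesis by (rule tendsto_unique[rotated]) simp
qed

section \<open>Expectations over the eigenvalues\<close>

text \<open>The density only determines the law of the unordered tuple of eigenvalues, so both sides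
  are compared as measures on the sigma-algebra of permutation invariant events.\<close>

lemma expectation_eigenvalues:
  fixes U :: "'a \<Rightarrow> complex^'n::finite^'n" and h :: "('n \<Rightarrow> complex) \<Rightarrow> complex"
  assumes dens: "has_eigenvalue_density M U p"
    and p [measurable]: "p \<in> borel_measurable torus_haar"
    and unitary: "\<And>x. x \<in> space M \<Longrightarrow> U x \<in> unitary_group"
    and h: "h \<in> borel_measurable torus_haar"
    and sym: "\<And>\<pi> z. \<pi> permutes UNIV \<Longrightarrow> z \<in> space torus_haar \<Longrightarrow> h (z \<circ> \<pi>) = h z"
  shows "(LINT x|M. h (eigenvalues (U x))) = (LINT z|torus_haar. p z * h z)"
proof -
  let ?\<Omega> = "space (torus_haar :: ('n \<Rightarrow> complex) measure)"
  define S :: "('n \<Rightarrow> complex) set set" where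
    "S = {B \<in> sets torus_haar. \<forall>\<pi>. bij \<pi> \<longrightarrow> (\<forall>z\<in>B. z \<circ> \<pi> \<in> B)}"
  have perm_space: "z \<circ> \<pi> \<in> ?\<Omega> \<longleftrightarrow> z \<in> ?\<Omega>" if "bij \<pi>" for z and \<pi> :: "'n \<Rightarrow> 'n"
    using bij_is_surj[OF that] by (auto simp: space_torus_haar) (metis surjD)
  have "sigma_algebra ?\<Omega> S"
    unfolding sigma_algebra_iff2
  proof (intro conjI ballI allI impI)
    show "S \<subseteq> Pow ?\<Omega>" using sets.sets_into_space by (auto simp: S_def)
    show "{} \<in> S" by (simp add: S_def)
    fix B assume B: "B \<in> S"
    have "z \<circ> \<pi> \<in> ?\<Omega> - B" if "bij \<pi>" "z \<in> ?\<Omega> - B" for z and \<pi> :: "'n \<Rightarrow> 'n"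
    proof -
      have "z \<circ> \<pi> \<notin> B"
      proof
        assume "z \<circ> \<pi> \<in> B"
        then have "(z \<circ> \<pi>) \<circ> inv \<pi> \<in> B" using B bij_imp_bij_inv[OF that(1)] by (auto simp: S_def)
        moreover have "(z \<circ> \<pi>) \<circ> inv \<pi> = z"
          using surj_f_inv_f[OF bij_is_surj[OF that(1)]] by (auto simp: fun_eq_iff)
        ultimately show False using that(2) by simp
      qed
      then show ?thesis using that perm_space by auto
    qed
    then show "?\<Omega> - B \<in> S" using B by (auto simp: S_def)
  next
    fix A :: "nat \<Rightarrow> ('n \<Rightarrow> complex) set" assume "range A \<subseteq> S"
    then show "(\<Union>i. A i) \<in> S" by (fastforce simp: S_def)
  qed
  then interpret S: sigma_algebra ?\<Omega> S .
  define \<Sigma> where "\<Sigma> = sigma ?\<Omega> S"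
  have sets\<Sigma>: "sets \<Sigma> = S" "space \<Sigma> = ?\<Omega>"
    unfolding \<Sigma>_def by (simp_all add: S.sets_measure_of_eq S.space_measure_of_eq)
  have eig: "eigenvalues (U x) \<in> ?\<Omega>" if "x \<in> space M" for x
    using norm_eigenvalue_unitary[OF unitary[OF that]] by (simp add: space_torus_haar)
  have vimage: "(\<lambda>x. eigenvalues (U x)) -` B \<inter> space M = {x \<in> space M. eigenvalues (U x) \<in> B}" for B
    by auto
  have meas: "{x \<in> space M. eigenvalues (U x) \<in> B} \<in> sets M"
      "emeasure M {x \<in> space M. eigenvalues (U x) \<in> B} = (\<integral>\<^sup>+z\<in>B. ennreal (Re (p z)) \<partial>torus_haar)"
    if "B \<in> S" for B
    using dens that by (auto simp: has_eigenvalue_density_def S_def)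
  have eig_meas: "(\<lambda>x. eigenvalues (U x)) \<in> measurable M \<Sigma>"
    by (rule measurableI) (use eig meas in \<open>auto simp: sets\<Sigma> vimage\<close>)
  let ?D = "density torus_haar (\<lambda>z. ennreal (Re (p z)))"
  have id_meas: "(\<lambda>z. z) \<in> measurable ?D \<Sigma>"
    by (rule measurableI) (auto simp: sets\<Sigma> S_def intro: sets.Int)
  \<comment> \<open>Symmetry of \<open>h\<close> makes its preimages permutation invariant, so it is
    measurable even for the coarser sigma-algebra.\<close>
  have h_meas: "h \<in> borel_measurable \<Sigma>"
  proof (rule measurableI)
    fix C :: "complex set" assume C: "C \<in> sets borel"
    have "h -` C \<inter> ?\<Omega> \<in> S"
      unfolding S_def
    proof (intro CollectI conjI allI impI ballI)
      show "h -` C \<inter> ?\<Omega> \<in> sets torus_haar" by (rule measurable_sets[OF h C])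
      fix \<pi> :: "'n \<Rightarrow> 'n" and z assume \<pi>: "bij \<pi>" and z: "z \<in> h -` C \<inter> ?\<Omega>"
      have "\<pi> permutes UNIV" using \<pi> by (intro bij_imp_permutes) simp_all
      then have "h (z \<circ> \<pi>) = h z" using z by (intro sym) simp_all
      then show "z \<circ> \<pi> \<in> h -` C \<inter> ?\<Omega>" using z perm_space[OF \<pi>, of z] by simp
    qed
    then show "h -` C \<inter> space \<Sigma> \<in> sets \<Sigma>" by (simp add: sets\<Sigma>)
  qed simp
  have distr: "distr M \<Sigma> (\<lambda>x. eigenvalues (U x)) = distr ?D \<Sigma> (\<lambda>z. z)"
  proof (rule measure_eqI)
    fix B assume "B \<in> sets (distr M \<Sigma> (\<lambda>x. eigenvalues (U x)))"
    then have B: "B \<in> S" by (simp add: sets\<Sigma>)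
    then have Bt: "B \<in> sets torus_haar" "B \<inter> ?\<Omega> = B"
      using sets.sets_into_space by (auto simp: S_def)
    have "emeasure (distr M \<Sigma> (\<lambda>x. eigenvalues (U x))) B = (\<integral>\<^sup>+z\<in>B. ennreal (Re (p z)) \<partial>torus_haar)"
      using B by (simp add: emeasure_distr[OF eig_meas] sets\<Sigma> vimage meas)
    also have "\<dots> = emeasure ?D B"
      using Bt by (simp add: emeasure_density)
    also have "\<dots> = emeasure (distr ?D \<Sigma> (\<lambda>z. z)) B"
      using B Bt by (simp add: emeasure_distr[OF id_meas] sets\<Sigma>)
    finally show "emeasure (distr M \<Sigma> (\<lambda>x. eigenvalues (U x))) B = emeasure (distr ?D \<Sigma> (\<lambda>z. z)) B" .
  qed simp
  have real: "AE z in torus_haar. p z \<in> \<real> \<and> 0 \<le> Re (p z)"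
    using dens by (simp add: has_eigenvalue_density_def)
  have "(LINT x|M. h (eigenvalues (U x))) = (LINT z|?D. h z)"
    using integral_distr[OF eig_meas h_meas] integral_distr[OF id_meas h_meas] distr by simp
  also have "\<dots> = (LINT z|torus_haar. Re (p z) *\<^sub>R h z)"
    using real h by (intro integral_density) auto
  also have "\<dots> = (LINT z|torus_haar. p z * h z)"
  proof (rule integral_cong_AE)
    show "AE z in torus_haar. Re (p z) *\<^sub>R h z = p z * h z"
      using real by eventually_elim (simp add: scaleR_conv_of_real)
  qed (use h in measurable)
  finally show ?thesis .
qed

lemma has_eigenvalue_density_cong:
  assumes "has_eigenvalue_density M U p" and eq: "AE z in torus_haar. p z = q z"
  shows "has_eigenvalue_density M U q"
proof -
  have "AE z in torus_haar. q z \<in> \<real> \<and> Re (q z) \<ge> 0"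
    using assms by (auto simp: has_eigenvalue_density_def elim!: eventually_elim2)
  moreover have "(\<integral>\<^sup>+z\<in>B. ennreal (Re (p z)) \<partial>torus_haar) = (\<integral>\<^sup>+z\<in>B. ennreal (Re (q z)) \<partial>torus_haar)" for B
    by (rule nn_integral_cong_AE) (use eq in \<open>eventually_elim, simp\<close>)
  ultimately show ?thesis
    using assms(1) unfolding has_eigenvalue_density_def by simp
qed

section \<open>The spherical transform of a cyclic Polya ensemble\<close>

text \<open>Equal to \<open>polya_density w\<close> almost everywhere, but measurable: the derivatives of \<open>w\<close> are
  integrable by assumption, those of \<open>- w\<close> differ from theirs in the unspecified values.\<close>

definition regular_polya_density ::
    "(complex \<Rightarrow> complex) \<Rightarrow> ('n::{finite,linorder} \<Rightarrow> complex) \<Rightarrow> complex" where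
  "regular_polya_density w z =
     1 / (fact CARD('n) * (\<Prod>j<CARD('n). fact j * circle_transform w (int j))) *
     vandermonde z * det (\<chi> a b. (- 1) ^ (pos b - 1) * (zderiv ^^ (pos b - 1)) w (z a))"

lemma pos_minus_1_le: "pos b - 1 \<le> CARD('n) - 1" for b :: "'n::{finite,linorder}"
proof -
  have "card {..<b} < CARD('n)" by (intro psubset_card_mono) auto
  then show ?thesis unfolding pos_minus_1 by simp
qed

lemma AE_polya_density_eq:
  assumes "w \<in> L1_diff CARD('n::{finite,linorder})"
  shows "AE z in (torus_haar :: ('n \<Rightarrow> complex) measure). polya_density w z = regular_polya_density w z"
proof -
  have "AE z in (torus_haar :: ('n \<Rightarrow> complex) measure). \<forall>b::'n. \<forall>a::'n.
      ((\<lambda>f x. - zderiv f x) ^^ (pos b - 1)) w (z a) = (- 1) ^ (pos b - 1) * (zderiv ^^ (pos b - 1)) w (z a)"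
    by (subst AE_all_countable, rule allI,
      rule AE_torus_component[OF AE_funpow_uminus_zderiv[OF assms pos_minus_1_le]])
  then show ?thesis
    by eventually_elim (simp add: polya_density_def regular_polya_density_def)
qed

lemma borel_measurable_regular_polya_density:
  assumes "w \<in> L1_diff CARD('n::{finite,linorder})"
  shows "regular_polya_density w \<in> borel_measurable (torus_haar :: ('n \<Rightarrow> complex) measure)"
proof -
  have "(\<lambda>z. (zderiv ^^ (pos b - 1)) w (z a)) \<in> borel_measurable (torus_haar :: ('n \<Rightarrow> complex) measure)"
    for a b :: 'n
  proof -
    have "(\<lambda>z::'n \<Rightarrow> complex. z a) \<in> measurable torus_haar circle_haar" by measurable
    from measurable_compose[OF this borel_measurable_integrable[OF L1_diff_integrable[OF assms pos_minus_1_le]]]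
    show ?thesis .
  qed
  then show ?thesis
    unfolding regular_polya_density_def[abs_def]
    by (intro borel_measurable_times borel_measurable_const borel_measurable_vandermonde borel_measurable_det)
qed

lemma prod_card_lessThan:
  "(\<Prod>j\<in>(UNIV::'n::{finite,linorder} set). F (card {..<j})) = (\<Prod>i<CARD('n). F i)"
  by (rule prod.reindex_bij_betw[OF bij_betw_card_lessThan])

lemma spherical_transform_cyclic_polya:
  fixes U :: "'a \<Rightarrow> complex^'n::{finite,linorder}^'n::{finite,linorder}" and s :: "'n \<Rightarrow> int"
  assumes ens: "cyclic_polya_ensemble M U w" and s: "inj s"
  shows "spherical_transform M U s =
    (\<Prod>j\<in>UNIV. circle_transform w (s j) / circle_transform w (int (pos j) - 1))"
proof -
  let ?T = "torus_haar :: ('n \<Rightarrow> complex) measure"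
  let ?N = "CARD('n)"
  have w: "w \<in> L1_diff ?N" using ens by (simp add: cyclic_polya_ensemble_def)
  have unitary: "\<And>x. x \<in> space M \<Longrightarrow> U x \<in> unitary_group"
    using ens by (simp add: cyclic_polya_ensemble_def random_unitary_def)
  have dens: "has_eigenvalue_density M U (regular_polya_density w)"
    using ens by (intro has_eigenvalue_density_cong[OF _ AE_polya_density_eq[OF w]])
      (simp add: cyclic_polya_ensemble_def)
  define V where "V = vandermonde (\<lambda>a. of_int (s a) :: complex)"
  define C where "C = 1 / (fact ?N * (\<Prod>j<?N. fact j * circle_transform w (int j)))"
  define F where "F = (\<Prod>j<?N. fact j :: complex)"
  have "inj (\<lambda>a. of_int (s a) :: complex)" using s by (auto simp: inj_def)
  then have V: "V \<noteq> 0" by (simp add: V_def vandermonde_eq_0_iff)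
  have F: "F \<noteq> 0" by (simp add: F_def)
  define g where "g b z = (- 1) ^ (pos b - 1) * (zderiv ^^ (pos b - 1)) w z" for b :: 'n and z
  have int: "integrable circle_haar (\<lambda>z. z powi s i * g j z)" for i j
    unfolding g_def
    by (intro integrable_circle_bounded_mult integrable_mult_right continuous_on_circle_powi
      L1_diff_integrable[OF w pos_minus_1_le])
  \<comment> \<open>The sign (-1)^(b-1) in the density cancels the one produced by integrating by
    parts b - 1 times.\<close>
  have moment: "(LINT z|circle_haar. z powi s i * g j z) = circle_transform w (s i) * of_int (s i) ^ (pos j - 1)" for i j
  proof -
    have "(LINT z|circle_haar. z powi s i * g j z) = (- 1) ^ (pos j - 1) * circle_transform ((zderiv ^^ (pos j - 1)) w) (s i)"
      unfolding circle_transform_def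
      by (subst integral_mult_right_zero[symmetric], rule Bochner_Integration.integral_cong)
        (simp_all add: g_def mult.left_commute)
    also have "\<dots> = (- 1) ^ (pos j - 1) * (- of_int (s i)) ^ (pos j - 1) * circle_transform w (s i)"
      unfolding circle_transform_zderiv_power[OF w pos_minus_1_le] by (simp only: mult.assoc)
    finally show ?thesis by (simp add: power_mult_distrib[symmetric])
  qed
  have "spherical_transform M U s = (LINT x|M. spherical_extension s (eigenvalues (U x)))"
    unfolding spherical_transform_def
    by (intro Bochner_Integration.integral_cong refl spherical_function_eq_extension unitary)
  also have "\<dots> = (LINT z|?T. regular_polya_density w z * spherical_extension s z)"
    by (intro expectation_eigenvalues dens borel_measurable_regular_polya_density w unitary
      borel_measurable_spherical_extension spherical_extension_permute) (auto simp: space_torus_haar)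
  also have "\<dots> = (LINT z|?T. (C * F / V) * (det (\<chi> a b. z a powi s b) * det (\<chi> a b. g b (z a))))"
  proof (rule Bochner_Integration.integral_cong[OF refl])
    fix z assume "z \<in> space ?T"
    then have "z a \<noteq> 0" for a by (metis (mono_tags) mem_Collect_eq norm_zero space_torus_haar zero_neq_one)
    from vandermonde_mult_spherical_extension[where z=z and s=s, OF this]
    have *: "vandermonde z * spherical_extension s z = F / V * det (\<chi> a b. z a powi s b)"
      by (simp add: F_def V_def)
    have "regular_polya_density w z * spherical_extension s z =
        C * det (\<chi> a b. g b (z a)) * (vandermonde z * spherical_extension s z)"
      by (simp add: regular_polya_density_def C_def g_def)
    then show "regular_polya_density w z * spherical_extension s z =
        (C * F / V) * (det (\<chi> a b. z a powi s b) * det (\<chi> a b. g b (z a)))"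
      unfolding * by simp
  qed
  also have "\<dots> = (C * F / V) * (LINT z|?T. det (\<chi> a b. z a powi s b) * det (\<chi> a b. g b (z a)))"
    by (rule integral_mult_right_zero)
  also have "\<dots> = (C * F / V) * (fact ?N * det (\<chi> i j. LINT z|circle_haar. z powi s i * g j z))"
    using andreief_identity[of "\<lambda>b z. z powi s b" g, OF int] by simp
  also have "det (\<chi> i j. LINT z|circle_haar. z powi s i * g j z) = (\<Prod>a\<in>UNIV. circle_transform w (s a)) * V"
  proof -
    have "(\<chi> i j. LINT z|circle_haar. z powi s i * g j z) =
        (\<chi> i. circle_transform w (s i) *s (\<chi> i j. of_int (s i) ^ (pos j - 1)) $ i)"
      by (simp add: vec_eq_iff moment)
    then have "det (\<chi> i j. LINT z|circle_haar. z powi s i * g j z) =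
        (\<Prod>a\<in>UNIV. circle_transform w (s a)) * det (\<chi> i j. of_int (s i) ^ (pos j - 1))"
      by (simp only: det_rows_mul) (simp add: vec_lambda_eta)
    then show ?thesis by (simp add: V_def vandermonde_eq_det)
  qed
  \<comment> \<open>The factorials in \<open>F\<close> and the N! of the Andreief identity cancel
    those in \<open>C\<close>, and the Vandermonde determinant \<open>V\<close> of s cancels the one
    in the denominator of the spherical function.\<close>
  also have "(C * F / V) * (fact ?N * ((\<Prod>a\<in>UNIV. circle_transform w (s a)) * V)) =
      (\<Prod>a\<in>UNIV. circle_transform w (s a)) / (\<Prod>j<?N. circle_transform w (int j))"
    using V F by (simp add: C_def F_def prod.distrib)
  also have "\<dots> = (\<Prod>j\<in>UNIV. circle_transform w (s j) / circle_transform w (int (pos j) - 1))"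
    using prod_card_lessThan[of "\<lambda>i. circle_transform w (int i)", where 'n='n]
    by (simp add: prod_dividef pos_eq_Suc)
  finally show ?thesis .
qed

section \<open>The inverse random matrix\<close>

text \<open>The index shift j -> N - 1 - j permutes {0, ..., N - 1}, so the normalising constant and
  its positivity are unchanged.\<close>

lemma prod_circle_transform_reflected:
  assumes "w \<in> borel_measurable circle_haar"
  shows "(\<Prod>j<N. circle_transform (reflected_weight N w) (int j)) = (\<Prod>j<N. circle_transform w (int j))"
proof -
  have "(\<Prod>j<N. circle_transform (reflected_weight N w) (int j)) = (\<Prod>j<N. circle_transform w (int (N - Suc j)))"
    by (rule prod.cong) (auto simp: circle_transform_reflected_weight[OF assms] of_nat_diff algebra_simps)
  also have "\<dots> = (\<Prod>j<N. circle_transform w (int j))" by (rule prod.nat_diff_reindex)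
  finally show ?thesis .
qed

lemma AE_polya_density_reflected:
  assumes w: "w \<in> L1_diff CARD('n::{finite,linorder})"
    and real: "(\<Prod>j<CARD('n). circle_transform w (int j)) \<in> \<real>"
  shows "AE z in (torus_haar :: ('n \<Rightarrow> complex) measure).
    polya_density (reflected_weight CARD('n) w) z = cnj (polya_density w (\<lambda>a. cnj (z a)))"
proof -
  let ?v = "reflected_weight CARD('n) w"
  have N1: "1 \<le> CARD('n)" by simp
  have wm: "w \<in> borel_measurable circle_haar"
    using L1_diff_integrable[OF w, of 0] by auto
  have refl: "AE z in circle_haar. ((\<lambda>f x. - zderiv f x) ^^ k) ?v z = cnj (((\<lambda>f x. - zderiv f x) ^^ k) w (cnj z))"
    if k: "k \<le> CARD('n) - 1" for k
    using AE_funpow_uminus_zderiv[OF L1_diff_reflected_weight(1)[OF w N1] k]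
      AE_circle_haar_cnj[OF AE_funpow_uminus_zderiv[OF w k]] L1_diff_reflected_weight(2)[OF w N1 k]
    by eventually_elim simp
  have "AE z in (torus_haar :: ('n \<Rightarrow> complex) measure). \<forall>b::'n. \<forall>a::'n.
      ((\<lambda>f x. - zderiv f x) ^^ (pos b - 1)) ?v (z a) = cnj (((\<lambda>f x. - zderiv f x) ^^ (pos b - 1)) w (cnj (z a)))"
    by (subst AE_all_countable, rule allI, rule AE_torus_component[OF refl[OF pos_minus_1_le]])
  then show ?thesis
  proof eventually_elim
    case (elim z)
    \<comment> \<open>Individual factors may be complex; only their product is known to be real, and
      that suffices for the constant.\<close>
    have c: "cnj (\<Prod>j<CARD('n). circle_transform w (int j)) = (\<Prod>j<CARD('n). circle_transform w (int j))"
      using real by (simp only: Reals_cnj_iff)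
    show ?case
      unfolding polya_density_def prod.distrib prod_circle_transform_reflected[OF wm]
        complex_cnj_mult complex_cnj_divide c cnj_det cnj_vandermonde
      using elim by (simp add: map_matrix_def)
  qed
qed

text \<open>Conjugation preserves the Haar measure of the torus, and the unknown permutation between
  the two enumerations of eigenvalues is invisible to symmetric events.\<close>

lemma has_eigenvalue_density_inverse:
  fixes U :: "'a \<Rightarrow> complex^'n::finite^'n"
  assumes dens: "has_eigenvalue_density M U p"
    and p: "p \<in> borel_measurable torus_haar"
    and unitary: "\<And>x. x \<in> space M \<Longrightarrow> U x \<in> unitary_group"
  shows "has_eigenvalue_density M (\<lambda>x. matrix_inv (U x)) (\<lambda>z. p (\<lambda>a. cnj (z a)))"
  unfolding has_eigenvalue_density_def
proof (intro conjI ballI impI)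
  let ?T = "torus_haar :: ('n \<Rightarrow> complex) measure"
  define c :: "('n \<Rightarrow> complex) \<Rightarrow> 'n \<Rightarrow> complex" where "c z = (\<lambda>a. cnj (z a))" for z
  have c_meas: "c \<in> measurable ?T ?T" unfolding c_def[abs_def] by (rule measurable_torus_cnj)
  have cc: "c (c z) = z" "c z \<circ> \<pi> = c (z \<circ> \<pi>)" for z \<pi> by (auto simp: c_def)
  show "AE z in ?T. p (\<lambda>a. cnj (z a)) \<in> \<real> \<and> 0 \<le> Re (p (\<lambda>a. cnj (z a)))"
    using dens by (intro AE_torus_cnj) (simp add: has_eigenvalue_density_def)
  fix B assume B: "B \<in> sets ?T" and symB: "\<forall>\<pi>. bij \<pi> \<longrightarrow> (\<forall>z\<in>B. z \<circ> \<pi> \<in> B)"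
  define B' where "B' = c -` B \<inter> space ?T"
  have B': "B' \<in> sets ?T" unfolding B'_def by (rule measurable_sets[OF c_meas B])
  have "z \<circ> \<pi> \<in> B'" if "bij \<pi>" "z \<in> B'" for z and \<pi> :: "'n \<Rightarrow> 'n"
    using that symB by (auto simp: B'_def cc(2)[symmetric] space_torus_haar)
  then have dB': "{x \<in> space M. eigenvalues (U x) \<in> B'} \<in> sets M"
      "emeasure M {x \<in> space M. eigenvalues (U x) \<in> B'} = (\<integral>\<^sup>+z\<in>B'. ennreal (Re (p z)) \<partial>?T)"
    using dens B' unfolding has_eigenvalue_density_def by blast+
  have iff: "eigenvalues (matrix_inv (U x)) \<in> B \<longleftrightarrow> eigenvalues (U x) \<in> B'" if x: "x \<in> space M" for x
  proof -
    obtain \<pi> where \<pi>: "\<pi> permutes UNIV"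
        "eigenvalues (adjoint_matrix (U x)) = (\<lambda>a. cnj (eigenvalues (U x) a)) \<circ> \<pi>"
      by (rule eigenvalues_adjoint)
    have e: "eigenvalues (matrix_inv (U x)) = c (eigenvalues (U x)) \<circ> \<pi>"
      using \<pi>(2) matrix_inv_unitary[OF unitary[OF x]] by (simp add: c_def)
    have bij: "bij \<pi>" "bij (inv \<pi>)" using permutes_bij[OF \<pi>(1)] bij_imp_bij_inv by auto
    have "eigenvalues (U x) \<in> space ?T"
      using norm_eigenvalue_unitary[OF unitary[OF x]] by (simp add: space_torus_haar)
    then have B'_iff: "eigenvalues (U x) \<in> B' \<longleftrightarrow> c (eigenvalues (U x)) \<in> B" by (simp add: B'_def)
    \<comment> \<open>Undoing the permutation gives the converse direction of the
      equivalence.\<close>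
    have "c (eigenvalues (U x)) = (c (eigenvalues (U x)) \<circ> \<pi>) \<circ> inv \<pi>"
      using permutes_inv_o(1)[OF \<pi>(1)] by (simp add: o_assoc[symmetric])
    then show ?thesis unfolding e B'_iff using symB bij by metis
  qed
  then have sets_eq: "{x \<in> space M. eigenvalues (matrix_inv (U x)) \<in> B} = {x \<in> space M. eigenvalues (U x) \<in> B'}"
    by auto
  show "{x \<in> space M. eigenvalues (matrix_inv (U x)) \<in> B} \<in> sets M"
    unfolding sets_eq by (rule dB')
  have g: "(\<lambda>z. ennreal (Re (p (c z))) * indicator B z) \<in> borel_measurable ?T"
    using p B measurable_compose[OF c_meas p] by measurable
  have "(\<integral>\<^sup>+z\<in>B'. ennreal (Re (p z)) \<partial>?T) = (\<integral>\<^sup>+z. ennreal (Re (p (c (c z)))) * indicator B (c z) \<partial>?T)"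
    by (rule nn_integral_cong) (simp add: cc B'_def split: split_indicator)
  also have "\<dots> = (\<integral>\<^sup>+z. ennreal (Re (p (c z))) * indicator B z \<partial>distr ?T ?T c)"
    using g by (intro nn_integral_distr[symmetric] c_meas) simp
  also have "distr ?T ?T c = ?T" unfolding c_def[abs_def] by (rule distr_torus_haar_cnj)
  finally show "emeasure M {x \<in> space M. eigenvalues (matrix_inv (U x)) \<in> B} =
      (\<integral>\<^sup>+z\<in>B. ennreal (Re (p (\<lambda>a. cnj (z a)))) \<partial>?T)"
    unfolding sets_eq dB' by (simp add: c_def)
qed

lemma measurable_adjoint_matrix: "adjoint_matrix \<in> borel_measurable borel"
  by (rule borel_measurable_continuous_onI) (rule continuous_adjoint_matrix)

lemma random_unitary_inverse:
  assumes "random_unitary M U"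
  shows "random_unitary M (\<lambda>x. matrix_inv (U x))"
proof -
  have inv: "matrix_inv (U x) = adjoint_matrix (U x)" if "x \<in> space M" for x
    using assms that by (simp add: random_unitary_def matrix_inv_unitary)
  have "(\<lambda>x. adjoint_matrix (U x)) \<in> borel_measurable M"
    using assms by (intro measurable_compose[OF _ measurable_adjoint_matrix]) (simp add: random_unitary_def)
  then have "(\<lambda>x. matrix_inv (U x)) \<in> borel_measurable M"
    using measurable_cong[of M "\<lambda>x. matrix_inv (U x)" "\<lambda>x. adjoint_matrix (U x)"] inv by blast
  then show ?thesis using assms inv by (simp add: random_unitary_def adjoint_unitary)
qed

text \<open>Conjugating the adjoint by V is the adjoint of conjugating by V, so the invariance is
  pushed forward along \<open>adjoint_matrix\<close>.\<close>

lemma unitarily_invariant_inverse: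
  fixes U :: "'a \<Rightarrow> complex^'n::finite^'n"
  assumes ru: "random_unitary M U" and ui: "unitarily_invariant M U"
  shows "unitarily_invariant M (\<lambda>x. matrix_inv (U x))"
  unfolding unitarily_invariant_def
proof
  fix V :: "complex^'n^'n" assume V: "V \<in> unitary_group"
  have inv: "matrix_inv (U x) = adjoint_matrix (U x)" if "x \<in> space M" for x
    using ru that by (simp add: random_unitary_def matrix_inv_unitary)
  have U: "U \<in> borel_measurable M" using ru by (simp add: random_unitary_def)
  have "continuous_on UNIV (\<lambda>A. V ** A ** adjoint_matrix V)"
    unfolding matrix_matrix_mult_def by (intro continuous_intros)
  then have conj: "(\<lambda>x. V ** U x ** adjoint_matrix V) \<in> borel_measurable M"
    by (intro measurable_compose[OF U] borel_measurable_continuous_onI)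
  have "distr M borel (\<lambda>x. V ** matrix_inv (U x) ** adjoint_matrix V) =
      distr M borel (\<lambda>x. adjoint_matrix (V ** U x ** adjoint_matrix V))"
    by (rule distr_cong) (auto simp: inv adjoint_matrix_mult matrix_mul_assoc)
  also have "\<dots> = distr (distr M borel (\<lambda>x. V ** U x ** adjoint_matrix V)) borel adjoint_matrix"
    using distr_distr[OF measurable_adjoint_matrix conj] by (simp add: o_def)
  also have "\<dots> = distr (distr M borel U) borel adjoint_matrix"
    using ui V by (simp add: unitarily_invariant_def)
  also have "\<dots> = distr M borel (\<lambda>x. adjoint_matrix (U x))"
    using distr_distr[OF measurable_adjoint_matrix U] by (simp add: o_def)
  also have "\<dots> = distr M borel (\<lambda>x. matrix_inv (U x))"
    by (rule distr_cong) (auto simp: inv)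
  finally show "distr M borel (\<lambda>x. V ** matrix_inv (U x) ** adjoint_matrix V) = distr M borel (\<lambda>x. matrix_inv (U x))" .
qed

lemma cyclic_polya_ensemble_inverse:
  fixes U :: "'a \<Rightarrow> complex^'n::{finite,linorder}^'n::{finite,linorder}"
  assumes ens: "cyclic_polya_ensemble M U w"
  shows "cyclic_polya_ensemble M (\<lambda>x. matrix_inv (U x)) (reflected_weight CARD('n) w)"
proof -
  let ?v = "reflected_weight CARD('n) w"
  have w: "w \<in> L1_diff CARD('n)" and ru: "random_unitary M U" and ui: "unitarily_invariant M U"
    and prod: "(\<Prod>j<CARD('n). circle_transform w (int j)) \<in> \<real>"
      "Re (\<Prod>j<CARD('n). circle_transform w (int j)) > 0"
    and dens: "has_eigenvalue_density M U (polya_density w)"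
    using ens by (simp_all add: cyclic_polya_ensemble_def)
  have unitary: "\<And>x. x \<in> space M \<Longrightarrow> U x \<in> unitary_group" using ru by (simp add: random_unitary_def)
  have wm: "w \<in> borel_measurable circle_haar"
    using L1_diff_integrable[OF w, of 0] by auto
  have eq: "AE z in torus_haar. polya_density w z = regular_polya_density w (z :: 'n \<Rightarrow> complex)"
    by (rule AE_polya_density_eq[OF w])
  \<comment> \<open>The change of variables requires a measurable density, hence the detour through
    the regular version.\<close>
  have "has_eigenvalue_density M (\<lambda>x. matrix_inv (U x)) (\<lambda>z. regular_polya_density w (\<lambda>a. cnj (z a)))"
    by (intro has_eigenvalue_density_inverse has_eigenvalue_density_cong[OF dens eq]
      borel_measurable_regular_polya_density w unitary)
  moreover have "AE z in torus_haar. regular_polya_density w (\<lambda>a. cnj (z a)) = polya_density ?v (z :: 'n \<Rightarrow> complex)"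
  proof -
    have "AE z in torus_haar. polya_density w (z :: 'n \<Rightarrow> complex) \<in> \<real>"
      using dens by (auto simp: has_eigenvalue_density_def elim: eventually_mono)
    from AE_torus_cnj[OF this] AE_torus_cnj[OF eq] AE_polya_density_reflected[OF w prod(1)]
    show ?thesis by eventually_elim (simp add: Reals_cnj_iff)
  qed
  ultimately have "has_eigenvalue_density M (\<lambda>x. matrix_inv (U x)) (polya_density ?v)"
    by (rule has_eigenvalue_density_cong)
  moreover have "?v \<in> L1_diff CARD('n)" by (rule L1_diff_reflected_weight(1)[OF w]) simp
  ultimately show ?thesis
    using random_unitary_inverse[OF ru] unitarily_invariant_inverse[OF ru ui] prod
    unfolding cyclic_polya_ensemble_def prod_circle_transform_reflected[OF wm] by blast
qed

theorem corollary6: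
  fixes M :: "'a measure"
    and U :: "'a \<Rightarrow> complex^'n::{finite,linorder}^'n::{finite,linorder}"
    and \<omega> :: "complex \<Rightarrow> complex"
  assumes "cyclic_polya_ensemble M U \<omega>"
  shows "(\<forall>s :: 'n \<Rightarrow> int. inj s \<longrightarrow>
            spherical_transform M U s =
              (\<Prod>j\<in>UNIV. circle_transform \<omega> (s j) / circle_transform \<omega> (int (pos j) - 1))) \<and>
         (\<forall>s :: 'n \<Rightarrow> int. inj s \<longrightarrow>
            spherical_transform M (\<lambda>x. matrix_inv (U x)) s =
              (\<Prod>j\<in>UNIV. circle_transform \<omega> (int CARD('n) - s j - 1) /
                          circle_transform \<omega> (int CARD('n) - int (pos j)))) \<and>
         cyclic_polya_ensemble M (\<lambda>x. matrix_inv (U x))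
           (\<lambda>z. z powi (1 - int CARD('n)) * \<omega> (inverse z)) \<and>
         (AE z in circle_haar.
            z powi (1 - int CARD('n)) * \<omega> (inverse z) = cnj (\<omega> (inverse z)))"
proof (intro conjI allI impI)
  have w: "\<omega> \<in> L1_diff CARD('n)" using assms by (simp add: cyclic_polya_ensemble_def)
  have wm: "\<omega> \<in> borel_measurable circle_haar"
    using L1_diff_integrable[OF w, of 0] by auto
  have inverse: "cyclic_polya_ensemble M (\<lambda>x. matrix_inv (U x)) (reflected_weight CARD('n) \<omega>)"
    by (rule cyclic_polya_ensemble_inverse[OF assms])
  show "spherical_transform M U s =
      (\<Prod>j\<in>UNIV. circle_transform \<omega> (s j) / circle_transform \<omega> (int (pos j) - 1))"
    if "inj s" for s :: "'n \<Rightarrow> int"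
    by (rule spherical_transform_cyclic_polya[OF assms that])
  show "spherical_transform M (\<lambda>x. matrix_inv (U x)) s =
      (\<Prod>j\<in>UNIV. circle_transform \<omega> (int CARD('n) - s j - 1) / circle_transform \<omega> (int CARD('n) - int (pos j)))"
    if "inj s" for s :: "'n \<Rightarrow> int"
    \<comment> \<open>At the index \<open>pos j - 1\<close> the shift gives N - (pos j - 1) - 1 = N
      - pos j, the denominator of the second formula.\<close>
    using spherical_transform_cyclic_polya[OF inverse that]
    by (simp add: circle_transform_reflected_weight[OF wm])
  show "cyclic_polya_ensemble M (\<lambda>x. matrix_inv (U x)) (\<lambda>z. z powi (1 - int CARD('n)) * \<omega> (inverse z))"
    using inverse by (simp add: reflected_weight_def[abs_def])
  have "\<omega> \<in> L1 CARD('n)" using w by (simp add: L1_diff_def)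
  then have "AE z in circle_haar. reflected_weight CARD('n) \<omega> z = cnj (\<omega> (cnj z))"
    by (rule AE_reflected_weight) simp
  then show "AE z in circle_haar. z powi (1 - int CARD('n)) * \<omega> (inverse z) = cnj (\<omega> (inverse z))"
    using AE_space
    by eventually_elim (simp add: reflected_weight_def inverse_eq_cnj_sphere)
qed

end
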